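(* Let $\mathcal{C}$ be a finite family of classifiers, let $L$ be a monotonic joint loss satisfying the continuity bound with parameter $R\ge0$, and suppose that, for any two groups $j,k\le K$ and any classifiers $c,c'\in\mathcal{C}$, $$\bigl|(\ell_j(c)-\ell_j(c'))-(\ell_k(c)-\ell_k(c'))\bigr|\le\Delta .$$ Then for the algorithm GeneralDecouple run with the down-weighting transfer learner $T$, with probability at least $1-\delta$ over the $n$ i.i.d. training examples from $\mathcal{D}$, the algorithm outputs $\hat c$ with $$L(\hat c)\le\min_{c\in\mathcal{C}}L(c)+5RK\tau+R\sum_{k=1}^K\min\left(\tau\sqrt{\frac1{\nu_k-\tau}},\ \Delta\right),$$ where $\tau=\sqrt{\frac2n\log\bigl(8|\mathcal{C}|(n+K)/\delta\bigr)}$, and where for $\nu_k<\tau$ the minimum is defined to be $\Delta$. For constant $K$, the run-time of the algorithm is polynomial in $n$ and the run-time of the optimizer over $\mathcal{C}$.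
   Context: Setting. The examples are partitioned by group, $\mathcal{X}=\mathcal{X}_1\cup\dots\cup\mathcal{X}_K$; $g(x)$ is the index of the group of $x$. Labels are in $\mathcal{Y}=\{0,1\}$ and classifications are in $\mathcal{Z}=[0,1]$ (randomized classifiers), so classifiers are functions $c:\mathcal{X}\to[0,1]$. $\mathcal{D}$ is a distribution on $\mathcal{X}\times\{0,1\}$ and the training examples $(x_1,y_1),\dots,(x_n,y_n)$ are drawn independently from $\mathcal{D}$. For $\vec c=(c_1,\dots,c_K)\in\mathcal{C}^K$, the decoupled classifier is $\gamma_{\vec c}(x)=c_{g(x)}(x)$. True quantities, for a classifier $c$: $\nu_k=\Pr[x\in\mathcal{X}_k]$, $p_k(c)=\mathrm{E}[c(x)\mathbb{I}[x\in\mathcal{X}_k]]$, and $\ell_k(c)=\mathrm{E}[|y-c(x)|\mid x\in\mathcal{X}_k]$ (defined as $0$ if $\nu_k=0$), where $\mathbb{I}$ is the indicator function. Empirical quantities: $n_k=|\{i:x_i\in\mathcal{X}_k\}|$, $n_{-k}=n-n_k$, $\hat p_k(c)=\frac1n\sum_{i:x_i\in\mathcal{X}_k}c(x_i)$, $\hat\ell_k(c)=\frac1{n_k}\sum_{i:x_i\in\mathcal{X}_k}|y_i-c(x_i)|$, and $\hat\ell_{-k}(c)=\frac1{n_{-k}}\sum_{i:x_i\notin\mathcal{X}_k}|y_i-c(x_i)|$ (each average taken to be $0$ if it is over an empty set). Joint loss. With the marginal distribution of (group, label) fixed, the joint loss is a function $L:[0,1]^{2K}\to\mathbb{R}$ of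 $(\ell_1,p_1,\dots,\ell_K,p_K)$, and $L(c)=L(\ell_1(c),p_1(c),\dots,\ell_K(c),p_K(c))$. Monotonic means: nondecreasing in each $\ell_k$ with all other arguments fixed. The continuity bound with parameter $R$ is: for all $\ell_k,\ell_k',p_k,p_k'\in[0,1]$, $$|L(\ell_1,p_1,\dots,\ell_K,p_K)-L(\ell_1',p_1',\dots,\ell_K',p_K')|\le R\sum_k\bigl(\nu_k|\ell_k-\ell_k'|+|p_k-p_k'|\bigr).$$ The empirical joint loss of a classifier is the same function evaluated at the empirical quantities, $\hat L(c)=L(\hat\ell_1,\hat p_1,\dots,\hat\ell_K,\hat p_K)$. Transfer learner $T$ for group $k$. $T$ runs the following subroutine $n_k+1\le n+1$ times, once for each possible value $P$ of $\hat p_k$. Let $\mathcal{C}_{kP}=\{c\in\mathcal{C}\mid\hat p_k(c)=P\}$. Whenever $\mathcal{C}_{kP}\neq\emptyset$, output one classifier in $\arg\min_{c\in\mathcal{C}_{kP}}\,n_k\hat\ell_k(c)+\theta\,n_{-k}\hat\ell_{-k}(c)$, that is, a minimizer of the empirical error when out-group examples are down-weighted by $\theta$; it is computed by an optimizer over $\mathcal{C}$, assumed optimal (given weighted examples, it returns a classifier in $\mathcal{C}_{kP}$ of minimal weighted error). Here $\theta=\theta_k\in[0,1]$ is chosen to minimize $f(\theta,n_k,n_{-k},\Delta,\delta')$ with $\delta'=\frac{\delta}{4(n+K)}$, where $$f(\theta,n_k,n_{-k},\Delta,\delta')=\frac1{n_k+\theta n_{-k}}\left(\sqrt{2(n_k+\theta^2n_{-k})\log\frac{2|\mathcal{C}|}{\delta'}}+\theta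 n_{-k}\Delta\right)$$ (if $n_k=0$, only $\theta>0$ is considered). The set of all classifiers so output is $C_k$. GeneralDecouple: for each $k=1,\dots,K$ run $T$ on the in-group examples $\langle x_i,y_i\rangle_{i:x_i\in\mathcal{X}_k}$ and out-group examples $\langle x_i,y_i\rangle_{i:x_i\notin\mathcal{X}_k}$ to obtain $C_k$, and compute $\hat p_k(c)$ and $\hat\ell_k(c)$ for all $c\in C_k$. Return $\hat c=\gamma_{\vec c}$ for a $\vec c=(c_1,\dots,c_K)\in C_1\times\dots\times C_K$ minimizing the empirical joint loss $L(\hat\ell_1(c_1),\hat p_1(c_1),\dots,\hat\ell_K(c_K),\hat p_K(c_K))$.
   Formalization: The run-time claim assumes that T tries at most n_k+1 values of the empirical rate p̂_k, as the algorithm's description says; this holds for 0/1-valued classifiers but can fail for randomized ones, where exponentially many rates may occur. The accuracy bound needs no such assumption. *)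

theory Defs
  imports
    "HOL-Probability.Probability"
    "HOL-Computational_Algebra.Polynomial"
    "HOL-Library.Monad_Syntax"
begin

text \<open>
  Examples are points of \<open>'x \<times> bool\<close>; the label \<open>y \<in> {0,1}\<close> is \<open>of_bool\<close> of the second
  component. The groups are the fibres of \<open>g\<close> over \<open>{1..K}\<close>. A randomized classifier is a function
  into \<open>[0,1]\<close>.
\<close>

type_synonym 'x classifier = "'x \<Rightarrow> real"
type_synonym 'x sample = "('x \<times> bool) list"

definition group_prob :: "('x \<times> bool) measure \<Rightarrow> ('x \<Rightarrow> nat) \<Rightarrow> nat \<Rightarrow> real" where
  "group_prob D g k = measure D {z \<in> space D. g (fst z) = k}"

definition true_rate :: "('x \<times> bool) measure \<Rightarrow> ('x \<Rightarrow> nat) \<Rightarrow> nat \<Rightarrow> 'x classifier \<Rightarrow> real" where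
  "true_rate D g k c = (\<integral>z. c (fst z) * of_bool (g (fst z) = k) \<partial>D)"

text \<open>Elementary conditional expectation given the event \<open>x \<in> X\<^sub>k\<close>.\<close>

definition true_loss :: "('x \<times> bool) measure \<Rightarrow> ('x \<Rightarrow> nat) \<Rightarrow> nat \<Rightarrow> 'x classifier \<Rightarrow> real" where
  "true_loss D g k c =
     (if group_prob D g k = 0 then 0
      else (\<integral>z. \<bar>of_bool (snd z) - c (fst z)\<bar> * of_bool (g (fst z) = k) \<partial>D) / group_prob D g k)"

definition decoupled :: "('x \<Rightarrow> nat) \<Rightarrow> (nat \<Rightarrow> 'x classifier) \<Rightarrow> 'x classifier" where
  "decoupled g cs = (\<lambda>x. cs (g x) x)"

text \<open>
  A joint loss takes the vectors \<open>(\<ell>\<^sub>1,\<dots>,\<ell>\<^sub>K)\<close> and \<open>(p\<^sub>1,\<dots>,p\<^sub>K)\<close>, as functions on indices of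
  which only the values on \<open>{1..K}\<close> are meaningful. The continuity bound forces \<open>L\<close> to ignore all
  other values.
\<close>

type_synonym joint_loss = "(nat \<Rightarrow> real) \<Rightarrow> (nat \<Rightarrow> real) \<Rightarrow> real"

definition monotonic_loss :: "nat \<Rightarrow> joint_loss \<Rightarrow> bool" where
  "monotonic_loss K L \<longleftrightarrow>
     (\<forall>l \<in> {1..K} \<rightarrow> {0..1}. \<forall>p \<in> {1..K} \<rightarrow> {0..1}. \<forall>k \<in> {1..K}. \<forall>v \<in> {0..1}.
        l k \<le> v \<longrightarrow> L l p \<le> L (l(k := v)) p)"

definition continuous_loss :: "nat \<Rightarrow> (nat \<Rightarrow> real) \<Rightarrow> real \<Rightarrow> joint_loss \<Rightarrow> bool" where
  "continuous_loss K \<nu> R L \<longleftrightarrow>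
     (\<forall>l \<in> {1..K} \<rightarrow> {0..1}. \<forall>l' \<in> {1..K} \<rightarrow> {0..1}.
      \<forall>p \<in> {1..K} \<rightarrow> {0..1}. \<forall>p' \<in> {1..K} \<rightarrow> {0..1}.
        \<bar>L l p - L l' p'\<bar> \<le> R * (\<Sum>k = 1..K. \<nu> k * \<bar>l k - l' k\<bar> + \<bar>p k - p' k\<bar>))"

definition true_joint_loss ::
  "('x \<times> bool) measure \<Rightarrow> ('x \<Rightarrow> nat) \<Rightarrow> joint_loss \<Rightarrow> 'x classifier \<Rightarrow> real" where
  "true_joint_loss D g L c = L (\<lambda>k. true_loss D g k c) (\<lambda>k. true_rate D g k c)"

text \<open>
  The learner for a group receives the in-group examples \<open>ins\<close> and the out-group examples \<open>outs\<close>,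
  so that \<open>n\<^sub>k = length ins\<close>, \<open>n\<^sub>-\<^sub>k = length outs\<close> and \<open>n = length ins + length outs\<close>. The
  empirical losses \<open>\<ell>\<close> of the group and of its complement are \<open>avg_err ins\<close> and
  \<open>avg_err outs\<close>; as \<open>0 / 0 = 0\<close>, they vanish on an empty sample. Note that the empirical rate
  divides by \<open>n\<close> and not by \<open>n\<^sub>k\<close>.
\<close>

definition avg_err :: "'x sample \<Rightarrow> 'x classifier \<Rightarrow> real" where
  "avg_err zs c = (\<Sum>(x, y) \<leftarrow> zs. \<bar>of_bool y - c x\<bar>) / real (length zs)"

definition emp_rate :: "'x sample \<Rightarrow> 'x sample \<Rightarrow> 'x classifier \<Rightarrow> real" where
  "emp_rate ins outs c = (\<Sum>(x, y) \<leftarrow> ins. c x) / real (length ins + length outs)"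

definition rate_class :: "'x classifier set \<Rightarrow> 'x sample \<Rightarrow> 'x sample \<Rightarrow> real \<Rightarrow> 'x classifier set" where
  "rate_class C ins outs P = {c \<in> C. emp_rate ins outs c = P}"

definition weighted_err :: "real \<Rightarrow> 'x sample \<Rightarrow> 'x sample \<Rightarrow> 'x classifier \<Rightarrow> real" where
  "weighted_err \<theta> ins outs c =
     real (length ins) * avg_err ins c + \<theta> * real (length outs) * avg_err outs c"

text \<open>The function \<open>f(\<theta>, n\<^sub>k, n\<^sub>-\<^sub>k, \<Delta>, \<delta>')\<close> for a family of \<open>m\<close> classifiers.\<close>

definition transfer_bound :: "nat \<Rightarrow> real \<Rightarrow> real \<Rightarrow> nat \<Rightarrow> nat \<Rightarrow> real \<Rightarrow> real" where
  "transfer_bound m \<Delta> \<delta>' a b \<theta> =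
     1 / (real a + \<theta> * real b) *
       (sqrt (2 * (real a + \<theta>\<^sup>2 * real b) * ln (2 * real m / \<delta>')) + \<theta> * real b * \<Delta>)"

text \<open>
  A rule \<open>weight\<close> choosing \<open>\<theta>\<close> from \<open>n\<^sub>k\<close> and \<open>n\<^sub>-\<^sub>k\<close>, for samples of size \<open>n\<close>.
\<close>

definition optimal_weight :: "nat \<Rightarrow> real \<Rightarrow> real \<Rightarrow> nat \<Rightarrow> (nat \<Rightarrow> nat \<Rightarrow> real) \<Rightarrow> bool" where
  "optimal_weight m \<Delta> \<delta>' n weight \<longleftrightarrow>
     (\<forall>a b. a + b = n \<longrightarrow>
        is_arg_min (transfer_bound m \<Delta> \<delta>' a b) (\<lambda>\<theta>. 0 \<le> \<theta> \<and> \<theta> \<le> 1 \<and> (a = 0 \<longrightarrow> 0 < \<theta>)) (weight a b))"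

datatype 'a timed = Timed (result: 'a) (steps: nat)

definition return_timed :: "'a \<Rightarrow> 'a timed" where
  "return_timed a = Timed a 0"

definition bind_timed :: "'a timed \<Rightarrow> ('a \<Rightarrow> 'b timed) \<Rightarrow> 'b timed" where
  "bind_timed m h = Timed (result (h (result m))) (steps m + steps (h (result m)))"

adhoc_overloading
  Monad_Syntax.bind \<rightleftharpoons> bind_timed

text \<open>
  One step stands for a bounded number of elementary operations: real arithmetic and comparisons,
  list operations, evaluating a classifier or \<open>g\<close> at a point, and evaluating the rule for \<open>\<theta>\<close>.
\<close>

definition step :: "'a \<Rightarrow> 'a timed" where
  "step a = Timed a 1"

fun fold_timed :: "('a \<Rightarrow> 'b \<Rightarrow> 'b timed) \<Rightarrow> 'a list \<Rightarrow> 'b \<Rightarrow> 'b timed" where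
  "fold_timed h [] s = step s"
| "fold_timed h (a # as) s = do { s1 \<leftarrow> h a s; s2 \<leftarrow> step s1; fold_timed h as s2 }"

fun map_timed :: "('a \<Rightarrow> 'b timed) \<Rightarrow> 'a list \<Rightarrow> 'b list timed" where
  "map_timed h [] = step []"
| "map_timed h (a # as) = do { b \<leftarrow> h a; bs \<leftarrow> map_timed h as; step (b # bs) }"

fun filter_timed :: "('a \<Rightarrow> bool) \<Rightarrow> 'a list \<Rightarrow> 'a list timed" where
  "filter_timed Q [] = step []"
| "filter_timed Q (a # as) = do { bs \<leftarrow> filter_timed Q as; step (if Q a then a # bs else bs) }"

definition length_timed :: "'a list \<Rightarrow> nat timed" where
  "length_timed as = fold_timed (\<lambda>_ m. return_timed (Suc m)) as 0"

definition sum_timed :: "('a \<Rightarrow> real) \<Rightarrow> 'a list \<Rightarrow> real timed" where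
  "sum_timed h as = fold_timed (\<lambda>a s. return_timed (s + h a)) as 0"

fun tuples_timed :: "'a list list \<Rightarrow> 'a list list timed" where
  "tuples_timed [] = step [[]]"
| "tuples_timed (as # ass) =
     do { ts \<leftarrow> tuples_timed ass;
          fold_timed (\<lambda>a acc. fold_timed (\<lambda>t acc'. return_timed ((a # t) # acc')) ts acc) as [] }"

definition argmin_timed :: "('a \<Rightarrow> real timed) \<Rightarrow> 'a list \<Rightarrow> 'a option timed" where
  "argmin_timed h as =
     do { best \<leftarrow> fold_timed
            (\<lambda>a best. do { v \<leftarrow> h a;
                            return_timed (case best of
                                None \<Rightarrow> Some (a, v)
                              | Some (b, w) \<Rightarrow> if v < w then Some (a, v) else Some (b, w)) })
            as None;
          step (map_option fst best) }"

lemma result_bind_timed [simp]: "result (bind_timed m h) = result (h (result m))"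
  and result_return_timed [simp]: "result (return_timed a) = a"
  and result_step [simp]: "result (step a) = a"
  by (simp_all add: bind_timed_def return_timed_def step_def)

lemma result_map_timed [simp]: "result (map_timed h as) = map (\<lambda>a. result (h a)) as"
  by (induction as) simp_all

lemma result_filter_timed [simp]: "result (filter_timed Q as) = filter Q as"
  by (induction as) simp_all

lemma result_fold_timed [simp]:
  "result (fold_timed h as s) = fold (\<lambda>a s. result (h a s)) as s"
  by (induction as arbitrary: s) simp_all

lemma result_length_timed [simp]: "result (length_timed as) = length as"
proof -
  have "fold (\<lambda>_. Suc) as m = m + length as" for m
    by (induction as arbitrary: m) simp_all
  then show ?thesis by (simp add: length_timed_def)
qed

lemma result_sum_timed [simp]: "result (sum_timed h as) = (\<Sum>a \<leftarrow> as. h a)"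
proof -
  have "fold (\<lambda>a s. s + h a) as s = s + (\<Sum>a \<leftarrow> as. h a)" for s
    by (induction as arbitrary: s) simp_all
  then show ?thesis by (simp add: sum_timed_def)
qed

lemma set_result_tuples_timed: "set (result (tuples_timed ass)) = set (product_lists ass)"
proof (induction ass)
  case (Cons as ass)
  have inner: "set (fold (\<lambda>t acc'. (a # t) # acc') ts acc) = (#) a ` set ts \<union> set acc"
    for a :: 'a and ts acc by (induction ts arbitrary: acc) auto
  have "set (fold (\<lambda>a acc. fold (\<lambda>t acc'. (a # t) # acc') ts acc) as acc) =
      (\<Union>a \<in> set as. (#) a ` set ts) \<union> set acc" for ts :: "'a list list" and acc
    by (induction as arbitrary: acc) (auto simp: inner)
  with Cons show ?case by simp
qed simp

text \<open>
  An optimizer is given the in-group examples with weight \<open>1\<close>, the out-group examples with weight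
  \<open>\<theta>\<close>, and the prescribed empirical rate \<open>P\<close>. It reports \<open>None\<close> if no classifier has that rate.
\<close>

type_synonym 'x optimizer = "'x sample \<Rightarrow> 'x sample \<Rightarrow> real \<Rightarrow> real \<Rightarrow> 'x classifier option timed"

definition optimal_optimizer :: "'x classifier set \<Rightarrow> 'x optimizer \<Rightarrow> bool" where
  "optimal_optimizer C opt \<longleftrightarrow>
     (\<forall>ins outs. \<forall>\<theta> \<in> {0..1}. \<forall>P.
        case result (opt ins outs \<theta> P) of
          None \<Rightarrow> rate_class C ins outs P = {}
        | Some c \<Rightarrow> is_arg_min (weighted_err \<theta> ins outs) (\<lambda>c. c \<in> rate_class C ins outs P) c)"

definition optimizer_time :: "'x optimizer \<Rightarrow> nat \<Rightarrow> nat \<Rightarrow> bool" where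
  "optimizer_time opt n t \<longleftrightarrow>
     (\<forall>ins outs. \<forall>\<theta> \<in> {0..1}. \<forall>P. length ins + length outs = n \<longrightarrow> steps (opt ins outs \<theta> P) \<le> t)"

text \<open>
  \<open>vals ins outs\<close> enumerates the possible values of the empirical rate of the group. Values that no
  classifier attains are allowed: for these the learner outputs nothing.
\<close>

type_synonym 'x rate_values = "'x sample \<Rightarrow> 'x sample \<Rightarrow> real list"

definition covers_rates :: "'x classifier set \<Rightarrow> 'x rate_values \<Rightarrow> bool" where
  "covers_rates C vals \<longleftrightarrow> (\<forall>ins outs. \<forall>c \<in> C. emp_rate ins outs c \<in> set (vals ins outs))"

text \<open>
  The number of subroutine runs claimed for the transfer learner. It is attained by
  deterministic classifiers, see \<open>covers_rates_deterministic\<close> below; a family of arbitrary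
  \<open>[0,1]\<close>-valued classifiers may have more distinct empirical rates.
\<close>

definition few_rates :: "'x rate_values \<Rightarrow> bool" where
  "few_rates vals \<longleftrightarrow> (\<forall>ins outs. length (vals ins outs) \<le> length ins + 1)"

lemma covers_rates_deterministic:
  fixes C :: "'x classifier set"
  assumes "\<And>c x. c \<in> C \<Longrightarrow> c x \<in> {0, 1}"
  defines "vals \<equiv> (\<lambda>ins outs :: 'x sample.
    map (\<lambda>j. real j / real (length ins + length outs)) [0..<length ins + 1])"
  shows "covers_rates C vals" and "few_rates vals"
proof -
  have "\<exists>j \<le> length ins. (\<Sum>(x, y) \<leftarrow> ins. c x) = real j"
    if "c \<in> C" for c and ins :: "'x sample"
  proof (induction ins)
    case (Cons z ins)
    then obtain j where j: "j \<le> length ins" "(\<Sum>(x, y) \<leftarrow> ins. c x) = real j" by blast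
    from assms(1)[OF that, of "fst z"] consider "c (fst z) = 0" | "c (fst z) = 1" by blast
    then show ?case
    proof cases
      case 1
      with j show ?thesis by (intro exI[of _ j]) (cases z, auto)
    next
      case 2
      with j show ?thesis by (intro exI[of _ "Suc j"]) (cases z, auto)
    qed
  qed simp
  then show "covers_rates C vals"
    unfolding covers_rates_def vals_def emp_rate_def by (force simp: less_Suc_eq_le)
  show "few_rates vals" by (simp add: few_rates_def vals_def)
qed

definition transfer_learner ::
  "(nat \<Rightarrow> nat \<Rightarrow> real) \<Rightarrow> 'x optimizer \<Rightarrow> 'x rate_values \<Rightarrow> 'x sample \<Rightarrow> 'x sample
     \<Rightarrow> 'x classifier list timed" where
  "transfer_learner weight opt vals ins outs =
     do { a \<leftarrow> length_timed ins;
          b \<leftarrow> length_timed outs;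
          \<theta> \<leftarrow> step (weight a b);
          fold_timed
            (\<lambda>P cs. do { r \<leftarrow> opt ins outs \<theta> P;
                          return_timed (case r of None \<Rightarrow> cs | Some c \<Rightarrow> c # cs) })
            (vals ins outs) [] }"

definition estimate_timed ::
  "'x sample \<Rightarrow> 'x sample \<Rightarrow> 'x classifier \<Rightarrow> ('x classifier \<times> real \<times> real) timed" where
  "estimate_timed ins outs c =
     do { a \<leftarrow> length_timed ins;
          b \<leftarrow> length_timed outs;
          e \<leftarrow> sum_timed (\<lambda>(x, y). \<bar>of_bool y - c x\<bar>) ins;
          s \<leftarrow> sum_timed (\<lambda>(x, y). c x) ins;
          step (c, e / real a, s / real (a + b)) }"

lemma result_estimate_timed:
  "result (estimate_timed ins outs c) = (c, avg_err ins c, emp_rate ins outs c)"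
  by (simp add: estimate_timed_def avg_err_def emp_rate_def)

text \<open>
  The empirical joint loss of a tuple with one entry per group. The list positions start at \<open>0\<close>,
  the groups at \<open>1\<close>. Reading off the \<open>K\<close> pairs of arguments and evaluating \<open>L\<close> is charged as
  \<open>K + 1\<close> steps.
\<close>

definition tuple_loss_timed ::
  "nat \<Rightarrow> joint_loss \<Rightarrow> ('x classifier \<times> real \<times> real) list \<Rightarrow> real timed" where
  "tuple_loss_timed K L t =
     Timed (L (\<lambda>k. fst (snd (t ! (k - 1)))) (\<lambda>k. snd (snd (t ! (k - 1))))) (K + 1)"

text \<open>The output is \<open>None\<close> only if the learner of some group returns no classifier.\<close>

definition general_decouple ::
  "nat \<Rightarrow> ('x \<Rightarrow> nat) \<Rightarrow> joint_loss \<Rightarrow> (nat \<Rightarrow> nat \<Rightarrow> real) \<Rightarrow> 'x optimizer \<Rightarrow> 'x rate_values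
     \<Rightarrow> 'x sample \<Rightarrow> 'x classifier option timed" where
  "general_decouple K g L weight opt vals zs =
     do { tables \<leftarrow> map_timed
            (\<lambda>k. do { ins \<leftarrow> filter_timed (\<lambda>z. g (fst z) = k) zs;
                       outs \<leftarrow> filter_timed (\<lambda>z. g (fst z) \<noteq> k) zs;
                       cs \<leftarrow> transfer_learner weight opt vals ins outs;
                       map_timed (estimate_timed ins outs) cs })
            [1..<K + 1];
          tuples \<leftarrow> tuples_timed tables;
          best \<leftarrow> argmin_timed (tuple_loss_timed K L) tuples;
          step (map_option (\<lambda>t. decoupled g (\<lambda>k. fst (t ! (k - 1)))) best) }"

definition deviation :: "nat \<Rightarrow> nat \<Rightarrow> nat \<Rightarrow> real \<Rightarrow> real" where
  "deviation m K n \<delta> = sqrt (2 / real n * ln (8 * real m * real (n + K) / \<delta>))"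

text \<open>
  At \<open>\<nu> = \<tau>\<close> the first argument of the minimum is infinite, so the minimum is \<open>\<Delta>\<close> there as well;
  without the case distinction, \<open>1 / 0 = 0\<close> would make it \<open>0\<close>.
\<close>

definition transfer_term :: "real \<Rightarrow> real \<Rightarrow> real \<Rightarrow> real" where
  "transfer_term \<tau> \<Delta> \<nu> = (if \<nu> \<le> \<tau> then \<Delta> else min (\<tau> * sqrt (1 / (\<nu> - \<tau>))) \<Delta>)"

end

theory Submission
  imports Defs
begin

text \<open>
  With \<open>\<lambda> = ln (8 |C| (n + K) / \<delta>)\<close>, so that \<open>\<tau> = sqrt (2 \<lambda> / n)\<close>, four two-sided Hoeffding bounds are used
  for each group \<open>k\<close> and each \<open>c \<in> C\<close>, failing with probability at most \<open>2 exp (- \<lambda>)\<close> each and hence at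
  most \<open>\<delta>\<close> in total: \<open>\<tau>/2\<close>-deviations of the empirical versions of \<open>p\<^sub>k(c)\<close>, \<open>\<nu>\<^sub>k\<close> and \<open>\<nu>\<^sub>k \<ell>\<^sub>k(c)\<close>,
  and the deviation of the down-weighted error from its mean given which examples lie in group \<open>k\<close>.
  The weight \<open>\<theta>\<close> of the last one depends on \<open>n\<^sub>k\<close>, so the exponential moment is bounded
  separately on each event that fixes the set of in-group indices; there the examples are still
  independent, and the probabilities of these events sum to \<open>1\<close>.

  On the good event the learner of group \<open>k\<close> outputs a classifier \<open>c'\<^sub>k\<close> with the same empirical
  rate as the best \<open>c \<in> C\<close> and \<open>\<ell>\<^sub>k(c'\<^sub>k) - \<ell>\<^sub>k(c) \<le> f(\<theta>\<^sub>k)\<close>. Comparing \<open>\<theta>\<^sub>k\<close> with \<open>\<theta> = 0\<close> and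
  \<open>\<theta> = 1\<close> bounds \<open>f(\<theta>\<^sub>k)\<close> by \<open>\<tau>\<close> plus the \<open>k\<close>-th minimum. Passing from true to empirical losses of
  the output and back for \<open>c'\<close> costs \<open>3/2 \<tau>\<close> per group each time, the rates of \<open>c'\<close> and \<open>c\<close>
  differ by at most \<open>\<tau>\<close>, and \<open>3/2 + 3/2 + 1 + 1 = 5\<close>.
\<close>

section \<open>Hoeffding bounds with a random weight\<close>

text \<open>\<open>uniform_measure M B\<close> is the law of an example conditioned on
  \<open>B\<close>, so this turns an integral restricted to \<open>B\<close> into a mean to which
  Hoeffding's lemma applies.\<close>

lemma expectation_uniform_measure:
  fixes f :: "'a \<Rightarrow> real"
  assumes "finite_measure M" "f \<in> borel_measurable M" "B \<in> sets M" "measure M B \<noteq> 0"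
  shows "(\<integral>x. f x \<partial>uniform_measure M B) = (\<integral>x. f x * indicator B x \<partial>M) / measure M B"
proof -
  interpret finite_measure M by fact
  have [measurable]: "f \<in> borel_measurable M" "B \<in> sets M" by fact+
  have "indicator B x / emeasure M B = ennreal (indicator B x / measure M B)" for x
    using assms(4) by (simp add: emeasure_eq_measure divide_ennreal zero_less_measure_iff flip: ennreal_indicator)
  then have "(\<integral>x. f x \<partial>uniform_measure M B) = (\<integral>x. (indicator B x / measure M B) *\<^sub>R f x \<partial>M)"
    unfolding uniform_measure_def by (simp add: integral_density)
  also have "\<dots> = (\<integral>x. f x * indicator B x / measure M B \<partial>M)"
    by (simp add: mult.commute)
  finally show ?thesis by simp
qed

text \<open>A negative exponent is handled by passing to \<open>- f\<close>, whose range
  \<open>[-1, 0]\<close> also has length 1. Both signs are needed because the lower tail is later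
  obtained as the upper tail for negated weights.\<close>

lemma hoeffding_lemma_signed:
  fixes f :: "'a \<Rightarrow> real"
  assumes "interval_bounded_random_variable M f 0 1"
  shows "(\<integral>\<^sup>+x. exp (s * (f x - (\<integral>x. f x \<partial>M))) \<partial>M) \<le> ennreal (exp (s\<^sup>2 / 8))"
proof -
  interpret interval_bounded_random_variable M f 0 1 by fact
  consider "s > 0" | "s = 0" | "s < 0" by linarith
  then show ?thesis
  proof cases
    case 1
    from Hoeffdings_lemma_nn_integral[OF this] show ?thesis by simp
  next
    case 2
    then show ?thesis by (simp add: emeasure_space_1)
  next
    case 3
    interpret neg: interval_bounded_random_variable M "\<lambda>x. - f x" "-1" 0
      by unfold_locales (auto intro!: eventually_mono[OF AE_in_interval])
    from 3 neg.Hoeffdings_lemma_nn_integral[of "- s"] show ?thesis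
      by (simp add: algebra_simps)
  qed
qed

text \<open>This is Hoeffding's lemma for the conditional law given \<open>B\<close>, multiplied
  through by the probability of \<open>B\<close>. In this form it survives a null event
  \<open>B\<close>, where both sides vanish and the hypothesis puts no constraint on \<mu>.\<close>

lemma hoeffding_lemma_on_event:
  fixes f :: "'a \<Rightarrow> real"
  assumes M: "prob_space M" and f [measurable]: "f \<in> borel_measurable M"
    and f01: "\<And>x. x \<in> space M \<Longrightarrow> f x \<in> {0..1}" and B [measurable]: "B \<in> sets M"
    and \<mu>: "(\<integral>x. f x * indicator B x \<partial>M) = \<mu> * measure M B"
  shows "(\<integral>\<^sup>+x. ennreal (exp (s * (f x - \<mu>))) * indicator B x \<partial>M) \<le> ennreal (exp (s\<^sup>2 / 8)) * emeasure M B"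
proof (cases "measure M B = 0")
  case True
  interpret prob_space M by fact
  from True have "B \<in> null_sets M" by (simp add: null_sets_def emeasure_eq_measure)
  then have "(\<integral>\<^sup>+x. ennreal (exp (s * (f x - \<mu>))) * indicator B x \<partial>M) = (\<integral>\<^sup>+x. 0 \<partial>M)"
    by (intro nn_integral_cong_AE) (auto dest!: AE_not_in elim!: eventually_mono)
  then show ?thesis by simp
next
  case False
  interpret prob_space M by fact
  have eB: "emeasure M B \<noteq> 0" "emeasure M B \<noteq> \<infinity>"
    using False by (auto simp: emeasure_eq_measure)
  interpret U: prob_space "uniform_measure M B"
    by (rule prob_space_uniform_measure[OF eB])
  have mean: "(\<integral>x. f x \<partial>uniform_measure M B) = \<mu>"
    using expectation_uniform_measure[OF finite_measure_axioms f B False] \<mu> False by simp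
  have "interval_bounded_random_variable (uniform_measure M B) f 0 1"
    using f01 by unfold_locales (auto simp: measurable_def)
  from hoeffding_lemma_signed[OF this, of s]
  have "(\<integral>\<^sup>+x. exp (s * (f x - \<mu>)) \<partial>uniform_measure M B) \<le> ennreal (exp (s\<^sup>2 / 8))"
    by (simp add: mean)
  then have "(\<integral>\<^sup>+x. ennreal (exp (s * (f x - \<mu>))) * indicator B x \<partial>M) / emeasure M B \<le> ennreal (exp (s\<^sup>2 / 8))"
    by (simp add: nn_integral_uniform_measure)
  then have "(\<integral>\<^sup>+x. ennreal (exp (s * (f x - \<mu>))) * indicator B x \<partial>M) / emeasure M B * emeasure M B
      \<le> ennreal (exp (s\<^sup>2 / 8)) * emeasure M B"
    by (rule mult_right_mono) simp
  then show ?thesis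
    using eB ennreal_divide_self[of "emeasure M B"]
    by (simp add: ennreal_divide_times less_top[symmetric])
qed

text \<open>The Chernoff argument restricted to a box. Both the exponential and the indicator of the
  box are products over the indices, so independence factorizes the integral, and every factor is
  bounded by Hoeffding's lemma on its own \<open>B i\<close>. The weights may have either sign and
  the means may vary with the index.\<close>

lemma hoeffding_on_box:
  fixes f :: "'a \<Rightarrow> real" and w \<mu> :: "'i \<Rightarrow> real" and t :: real
  assumes M: "prob_space M" and f [measurable]: "f \<in> borel_measurable M"
    and f01: "\<And>x. x \<in> space M \<Longrightarrow> f x \<in> {0..1}"
    and I: "finite I" and B [measurable]: "\<And>i. i \<in> I \<Longrightarrow> B i \<in> sets M"
    and \<mu>: "\<And>i. i \<in> I \<Longrightarrow> (\<integral>x. f x * indicator (B i) x \<partial>M) = \<mu> i * measure M (B i)"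
    and t: "0 \<le> t" and V: "0 < (\<Sum>i\<in>I. (w i)\<^sup>2)"
  shows "emeasure (Pi\<^sub>M I (\<lambda>_. M))
      {S \<in> space (Pi\<^sub>M I (\<lambda>_. M)). (\<forall>i\<in>I. S i \<in> B i) \<and> t \<le> (\<Sum>i\<in>I. w i * (f (S i) - \<mu> i))}
    \<le> ennreal (exp (- 2 * t\<^sup>2 / (\<Sum>i\<in>I. (w i)\<^sup>2))) * (\<Prod>i\<in>I. emeasure M (B i))"
    (is "emeasure ?P ?E \<le> _")
proof -
  interpret prob_space M by fact
  interpret P: product_prob_space "\<lambda>_ :: 'i. M" I by unfold_locales
  define V where "V = (\<Sum>i\<in>I. (w i)\<^sup>2)"
  \<comment> \<open>This choice minimizes - s t + s^2 V / 8, the exponent reached at the end; the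
    minimum is - 2 t^2 / V.\<close>
  define s where "s = 4 * t / V"
  have V0: "0 < V" and s: "0 \<le> s" using V t by (auto simp: V_def s_def)
  let ?h = "\<lambda>i x. ennreal (exp (s * w i * (f x - \<mu> i))) * indicator (B i) x"
  \<comment> \<open>Markov's inequality for the exponential, in pointwise form.\<close>
  have pointwise: "indicator ?E S \<le> ennreal (exp (- (s * t))) * (\<Prod>i\<in>I. ?h i (S i))" for S
  proof (cases "S \<in> ?E")
    case True
    have "(\<Prod>i\<in>I. ?h i (S i)) = (\<Prod>i\<in>I. ennreal (exp (s * w i * (f (S i) - \<mu> i))))"
      using True by (intro prod.cong) auto
    also have "\<dots> = ennreal (exp (s * (\<Sum>i\<in>I. w i * (f (S i) - \<mu> i))))"
      by (simp add: prod_ennreal exp_sum[OF I] sum_distrib_left mult.assoc)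
    also have "\<dots> \<ge> ennreal (exp (s * t))"
      using True s by (intro ennreal_leI) (auto intro: mult_left_mono)
    finally have "ennreal (exp (- (s * t))) * ennreal (exp (s * t)) \<le> ennreal (exp (- (s * t))) * (\<Prod>i\<in>I. ?h i (S i))"
      by (intro mult_left_mono) auto
    then show ?thesis using True by (simp add: ennreal_mult[symmetric] exp_minus_inverse flip: exp_add)
  qed simp
  have "emeasure ?P ?E \<le> (\<integral>\<^sup>+S. ennreal (exp (- (s * t))) * (\<Prod>i\<in>I. ?h i (S i)) \<partial>?P)"
  proof -
    have "?E \<in> sets ?P" using I by measurable
    then have "emeasure ?P ?E = (\<integral>\<^sup>+S. indicator ?E S \<partial>?P)" by simp
    also have "\<dots> \<le> (\<integral>\<^sup>+S. ennreal (exp (- (s * t))) * (\<Prod>i\<in>I. ?h i (S i)) \<partial>?P)"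
      by (intro nn_integral_mono pointwise)
    finally show ?thesis .
  qed
  also have "\<dots> = ennreal (exp (- (s * t))) * (\<integral>\<^sup>+S. (\<Prod>i\<in>I. ?h i (S i)) \<partial>?P)"
    by (intro nn_integral_cmult) measurable
  also have "(\<integral>\<^sup>+S. (\<Prod>i\<in>I. ?h i (S i)) \<partial>?P) = (\<Prod>i\<in>I. \<integral>\<^sup>+x. ?h i x \<partial>M)"
    using I by (intro P.product_nn_integral_prod) auto
  also have "\<dots> \<le> (\<Prod>i\<in>I. ennreal (exp ((s * w i)\<^sup>2 / 8)) * emeasure M (B i))"
    using M f f01 B \<mu> by (intro prod_mono_ennreal hoeffding_lemma_on_event) auto
  also have "\<dots> = ennreal (exp (s\<^sup>2 * V / 8)) * (\<Prod>i\<in>I. emeasure M (B i))"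
    by (simp add: prod.distrib prod_ennreal V_def sum_distrib_left sum_divide_distrib exp_sum[OF I]
        power_mult_distrib)
  also have "ennreal (exp (- (s * t))) * \<dots> = ennreal (exp (- (s * t)) * exp (s\<^sup>2 * V / 8)) * (\<Prod>i\<in>I. emeasure M (B i))"
    by (simp add: ennreal_mult mult.assoc)
  also have "exp (- (s * t)) * exp (s\<^sup>2 * V / 8) = exp (- 2 * t\<^sup>2 / V)"
    using V0 by (simp add: s_def field_simps power2_eq_square flip: exp_add)
  finally show ?thesis by (simp add: V_def mult_left_mono)
qed

definition weighted_deviation ::
  "'i set \<Rightarrow> 'a set \<Rightarrow> ('a \<Rightarrow> real) \<Rightarrow> real \<Rightarrow> real \<Rightarrow> real \<Rightarrow> ('i \<Rightarrow> 'a) \<Rightarrow> real" where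
  "weighted_deviation I B f \<mu>1 \<mu>0 \<theta> S = (\<Sum>i\<in>I. if S i \<in> B then f (S i) - \<mu>1 else \<theta> * (f (S i) - \<mu>0))"

text \<open>The threshold t solves 2 t^2 / V = \<open>lam\<close>, where V = a + \<theta>^2 b is the
  sum of the squared weights. Here \<theta> is a function of the number of examples in
  \<open>B\<close>, so that V and the threshold are themselves random.\<close>

definition deviation_event ::
  "'a measure \<Rightarrow> 'i set \<Rightarrow> 'a set \<Rightarrow> ('a \<Rightarrow> real) \<Rightarrow> real \<Rightarrow> real \<Rightarrow> (nat \<Rightarrow> real) \<Rightarrow> real \<Rightarrow> ('i \<Rightarrow> 'a) set" where
  "deviation_event M I B f \<mu>1 \<mu>0 \<theta> lam = {S \<in> space (Pi\<^sub>M I (\<lambda>_. M)).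
     let a = card {i \<in> I. S i \<in> B}; b = card {i \<in> I. S i \<notin> B} in
       sqrt ((real a + (\<theta> a)\<^sup>2 * real b) * lam / 2) \<le> \<bar>weighted_deviation I B f \<mu>1 \<mu>0 (\<theta> a) S\<bar>}"

text \<open>The event is cut into cells according to the set \<open>A\<close> of indices whose
  example lies in \<open>B\<close>. On a cell the weights, the means and the threshold are
  constants, so \<open>hoeffding_on_box\<close> applies and yields exp (- \<open>lam\<close>) times
  the probability of the cell. Since that factor is kept, summing over all 2^n patterns costs
  nothing.\<close>

lemma deviation_event:
  fixes f :: "'a \<Rightarrow> real" and I :: "'i set"
  assumes M: "prob_space M" and f [measurable]: "f \<in> borel_measurable M"
    and f01: "\<And>x. x \<in> space M \<Longrightarrow> f x \<in> {0..1}" and B [measurable]: "B \<in> sets M"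
    and \<mu>1: "(\<integral>x. f x * indicator B x \<partial>M) = \<mu>1 * measure M B"
    and \<mu>0: "(\<integral>x. f x * indicator (space M - B) x \<partial>M) = \<mu>0 * measure M (space M - B)"
    and I: "finite I" and lam: "0 \<le> lam"
    and V: "\<And>a b. a + b = card I \<Longrightarrow> 0 < real a + (\<theta> a)\<^sup>2 * real b"
  shows "deviation_event M I B f \<mu>1 \<mu>0 \<theta> lam \<in> sets (Pi\<^sub>M I (\<lambda>_. M))"
    and "measure (Pi\<^sub>M I (\<lambda>_. M)) (deviation_event M I B f \<mu>1 \<mu>0 \<theta> lam) \<le> 2 * exp (- lam)"
proof -
  interpret prob_space M by fact
  interpret P: product_prob_space "\<lambda>_ :: 'i. M" I by unfold_locales
  let ?P = "Pi\<^sub>M I (\<lambda>_. M)"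
  define Bx where "Bx A i = (if i \<in> A then B else space M - B)" for A and i :: 'i
  define \<mu> where "\<mu> A i = (if i \<in> A then \<mu>1 else \<mu>0)" for A and i :: 'i
  \<comment> \<open>The sign \<epsilon> is 1 for the upper tail and -1 for the lower tail.\<close>
  define w where "w \<epsilon> A i = \<epsilon> * (if i \<in> A then 1 else \<theta> (card A))" for \<epsilon> A and i :: 'i
  define t where "t A = sqrt ((real (card A) + (\<theta> (card A))\<^sup>2 * real (card (I - A))) * lam / 2)" for A :: "'i set"
  define E where "E \<epsilon> A = {S \<in> space ?P. (\<forall>i\<in>I. S i \<in> Bx A i) \<and> t A \<le> (\<Sum>i\<in>I. w \<epsilon> A i * (f (S i) - \<mu> A i))}" for \<epsilon> A
  have [measurable]: "Bx A i \<in> sets M" for A i by (simp add: Bx_def)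
  have E_sets [measurable]: "E \<epsilon> A \<in> sets ?P" for \<epsilon> A
    unfolding E_def using I by measurable
  have "deviation_event M I B f \<mu>1 \<mu>0 \<theta> lam = (\<Union>A\<in>Pow I. E 1 A \<union> E (-1) A)" (is "?D = ?U")
  proof -
    have "S \<in> ?D \<longleftrightarrow> S \<in> ?U" if S: "S \<in> space ?P" for S
    proof -
      \<comment> \<open>The boxes are disjoint and cover the space: a sample lies in exactly one of
        them, namely the one of its own index set.\<close>
      have pattern: "(\<forall>i\<in>I. S i \<in> Bx A i) \<longleftrightarrow> A = {i \<in> I. S i \<in> B}" if "A \<subseteq> I" for A
        using that S by (auto simp: Bx_def space_PiM PiE_def Pi_def split: if_splits)
      define A where "A = {i \<in> I. S i \<in> B}"
      have "S \<in> ?U \<longleftrightarrow> S \<in> E 1 A \<union> E (-1) A"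
        using pattern by (auto simp: E_def A_def)
      also have "\<dots> \<longleftrightarrow> t A \<le> (\<Sum>i\<in>I. w 1 A i * (f (S i) - \<mu> A i)) \<or> t A \<le> (\<Sum>i\<in>I. w (-1) A i * (f (S i) - \<mu> A i))"
        using pattern[of A] S by (auto simp: E_def A_def)
      also have "(\<Sum>i\<in>I. w 1 A i * (f (S i) - \<mu> A i)) = weighted_deviation I B f \<mu>1 \<mu>0 (\<theta> (card A)) S"
        unfolding weighted_deviation_def by (intro sum.cong) (auto simp: w_def \<mu>_def A_def)
      also have "(\<Sum>i\<in>I. w (-1) A i * (f (S i) - \<mu> A i)) = - weighted_deviation I B f \<mu>1 \<mu>0 (\<theta> (card A)) S"
        unfolding weighted_deviation_def sum_negf[symmetric] by (intro sum.cong) (auto simp: w_def \<mu>_def A_def)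
      also have "I - A = {i \<in> I. S i \<notin> B}" by (auto simp: A_def)
      then have "t A \<le> \<bar>weighted_deviation I B f \<mu>1 \<mu>0 (\<theta> (card A)) S\<bar> \<longleftrightarrow> S \<in> ?D"
        using S by (simp add: deviation_event_def t_def Let_def flip: A_def)
      then have "(t A \<le> weighted_deviation I B f \<mu>1 \<mu>0 (\<theta> (card A)) S \<or> t A \<le> - weighted_deviation I B f \<mu>1 \<mu>0 (\<theta> (card A)) S) \<longleftrightarrow> S \<in> ?D"
        by arith
      finally show ?thesis by simp
    qed
    moreover have "?D \<subseteq> space ?P" "?U \<subseteq> space ?P"
      by (auto simp: deviation_event_def E_def)
    ultimately show ?thesis by blast
  qed
  note D_eq = this
  show "?D \<in> sets ?P" unfolding D_eq using I by (intro sets.finite_UN) auto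
  have E_le: "emeasure ?P (E \<epsilon> A) \<le> ennreal (exp (- lam)) * (\<Prod>i\<in>I. emeasure M (Bx A i))"
    if A: "A \<in> Pow I" and \<epsilon>: "\<epsilon> \<in> {1, -1}" for A \<epsilon>
  proof -
    have fin: "finite A" using A I finite_subset by auto
    have "(\<Sum>i\<in>I. (w \<epsilon> A i)\<^sup>2) = (\<Sum>i\<in>I. if i \<in> A then 1 else (\<theta> (card A))\<^sup>2)"
      using \<epsilon> by (intro sum.cong) (auto simp: w_def)
    also have "\<dots> = real (card A) + (\<theta> (card A))\<^sup>2 * real (card (I - A))"
      using A I by (simp add: sum.If_cases Int_absorb1 Diff_eq[symmetric] Compl_eq_Diff_UNIV[symmetric])
    finally have sum_w: "(\<Sum>i\<in>I. (w \<epsilon> A i)\<^sup>2) = real (card A) + (\<theta> (card A))\<^sup>2 * real (card (I - A))" .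
    have pos: "0 < real (card A) + (\<theta> (card A))\<^sup>2 * real (card (I - A))"
      using A I fin by (intro V) (auto simp: card_Diff_subset card_mono)
    have t2: "(t A)\<^sup>2 = (real (card A) + (\<theta> (card A))\<^sup>2 * real (card (I - A))) * lam / 2"
      using pos lam by (simp add: t_def)
    have exponent: "- 2 * (t A)\<^sup>2 / (\<Sum>i\<in>I. (w \<epsilon> A i)\<^sup>2) = - lam"
      unfolding sum_w t2 using pos by (simp add: field_simps)
    have "emeasure ?P (E \<epsilon> A) \<le> ennreal (exp (- 2 * (t A)\<^sup>2 / (\<Sum>i\<in>I. (w \<epsilon> A i)\<^sup>2))) * (\<Prod>i\<in>I. emeasure M (Bx A i))"
      unfolding E_def
    proof (rule hoeffding_on_box[OF M f f01 I])
      show "(\<integral>x. f x * indicator (Bx A i) x \<partial>M) = \<mu> A i * measure M (Bx A i)" for i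
        using \<mu>1 \<mu>0 by (simp add: Bx_def \<mu>_def)
      show "0 \<le> t A" using pos lam by (simp add: t_def)
      show "0 < (\<Sum>i\<in>I. (w \<epsilon> A i)\<^sup>2)" unfolding sum_w by (fact pos)
    qed auto
    then show ?thesis unfolding exponent .
  qed
  \<comment> \<open>The cell probabilities are the terms obtained by multiplying out the product
    over \<open>I\<close> of the probabilities of \<open>B\<close> plus its complement, each factor
    of which is 1.\<close>
  have "(\<Sum>A\<in>Pow I. \<Prod>i\<in>I. emeasure M (Bx A i)) = (\<Sum>A\<in>Pow I. (\<Prod>i\<in>A. emeasure M B) * (\<Prod>i\<in>I - A. emeasure M (space M - B)))"
  proof (rule sum.cong)
    fix A assume "A \<in> Pow I"
    then show "(\<Prod>i\<in>I. emeasure M (Bx A i)) = (\<Prod>i\<in>A. emeasure M B) * (\<Prod>i\<in>I - A. emeasure M (space M - B))"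
      using I by (subst prod.subset_diff[of A I]) (auto simp: Bx_def mult.commute)
  qed simp
  also have "\<dots> = (\<Prod>i\<in>I. emeasure M B + emeasure M (space M - B))"
    using I by (rule prod_add[symmetric])
  also have "emeasure M B + emeasure M (space M - B) = 1"
    by (subst plus_emeasure) (auto simp: emeasure_space_1 Un_absorb1 sets.sets_into_space)
  finally have total: "(\<Sum>A\<in>Pow I. \<Prod>i\<in>I. emeasure M (Bx A i)) = 1" by simp
  have "emeasure ?P ?D \<le> (\<Sum>A\<in>Pow I. emeasure ?P (E 1 A \<union> E (-1) A))"
    unfolding D_eq using I by (intro emeasure_subadditive_finite) auto
  also have "\<dots> \<le> (\<Sum>A\<in>Pow I. 2 * ennreal (exp (- lam)) * (\<Prod>i\<in>I. emeasure M (Bx A i)))"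
  proof (rule sum_mono)
    fix A assume A: "A \<in> Pow I"
    have "emeasure ?P (E 1 A \<union> E (-1) A) \<le> emeasure ?P (E 1 A) + emeasure ?P (E (-1) A)"
      by (rule emeasure_subadditive) auto
    also have "\<dots> \<le> ennreal (exp (- lam)) * (\<Prod>i\<in>I. emeasure M (Bx A i)) + ennreal (exp (- lam)) * (\<Prod>i\<in>I. emeasure M (Bx A i))"
      using A by (intro add_mono E_le) auto
    finally show "emeasure ?P (E 1 A \<union> E (-1) A) \<le> 2 * ennreal (exp (- lam)) * (\<Prod>i\<in>I. emeasure M (Bx A i))"
      by (simp add: mult_2 distrib_right)
  qed
  also have "\<dots> = 2 * ennreal (exp (- lam))"
    unfolding sum_distrib_left[symmetric] total by simp
  also have "\<dots> = ennreal (2 * exp (- lam))" by (simp add: ennreal_mult)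
  finally show "measure ?P ?D \<le> 2 * exp (- lam)"
    by (simp add: P.P.emeasure_eq_measure)
qed

text \<open>The ordinary Hoeffding bound, read off from the weighted one by taking the whole space
  for \<open>B\<close>, so that every example counts with weight 1.\<close>

lemma mean_deviation_event:
  fixes f :: "'a \<Rightarrow> real" and M :: "'a measure" and n :: nat and lam :: real
  defines "E \<equiv> {S \<in> space (Pi\<^sub>M {..<n} (\<lambda>_. M)). sqrt (2 / real n * lam) / 2 \<le> \<bar>(\<Sum>i<n. f (S i)) / real n - (\<integral>x. f x \<partial>M)\<bar>}"
  assumes M: "prob_space M" and f: "f \<in> borel_measurable M"
    and f01: "\<And>x. x \<in> space M \<Longrightarrow> f x \<in> {0..1}" and n: "0 < n" and lam: "0 \<le> lam"
  shows "E \<in> sets (Pi\<^sub>M {..<n} (\<lambda>_. M))" and "measure (Pi\<^sub>M {..<n} (\<lambda>_. M)) E \<le> 2 * exp (- lam)"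
proof -
  interpret prob_space M by fact
  let ?\<mu> = "\<integral>x. f x \<partial>M"
  have eq: "E = deviation_event M {..<n} (space M) f ?\<mu> 0 (\<lambda>_. 1) lam"
  proof -
    have "(sqrt (2 / real n * lam) / 2 \<le> \<bar>(\<Sum>i<n. f (S i)) / real n - ?\<mu>\<bar>) \<longleftrightarrow>
        S \<in> deviation_event M {..<n} (space M) f ?\<mu> 0 (\<lambda>_. 1) lam" if S: "S \<in> space (Pi\<^sub>M {..<n} (\<lambda>_. M))" for S
    proof -
      have in_space: "S i \<in> space M" if "i < n" for i using S that by (auto simp: space_PiM)
      have card: "{i \<in> {..<n}. S i \<in> space M} = {..<n}" "{i \<in> {..<n}. S i \<notin> space M} = {}"
        using in_space by auto
      have "weighted_deviation {..<n} (space M) f ?\<mu> 0 1 S = (\<Sum>i<n. f (S i) - ?\<mu>)"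
        unfolding weighted_deviation_def using in_space by (intro sum.cong) auto
      also have "\<dots> = (\<Sum>i<n. f (S i)) - real n * ?\<mu>" by (simp add: sum_subtractf)
      finally have "(\<Sum>i<n. f (S i)) / real n - ?\<mu> = weighted_deviation {..<n} (space M) f ?\<mu> 0 1 S / real n"
        using n by (simp add: field_simps)
      then have "\<bar>(\<Sum>i<n. f (S i)) / real n - ?\<mu>\<bar> = \<bar>weighted_deviation {..<n} (space M) f ?\<mu> 0 1 S\<bar> / real n"
        by (simp only: abs_divide abs_of_nat)
      \<comment> \<open>The threshold for the sum has V = n; dividing it by n gives half of the
        \<tau> of the theorem.\<close>
      moreover have "sqrt (2 / real n * lam) / 2 = sqrt (real n * lam / 2) / real n"
      proof -
        have "real n * lam / 2 = (2 / real n * lam) * (real n / 2)\<^sup>2"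
          using n by (simp add: power2_eq_square)
        then have "sqrt (real n * lam / 2) = sqrt (2 / real n * lam) * (real n / 2)"
          by (simp only: real_sqrt_mult real_sqrt_abs abs_divide abs_of_nat abs_numeral)
        then show ?thesis using n by simp
      qed
      ultimately show ?thesis
        using S n unfolding deviation_event_def mem_Collect_eq card Let_def by (simp add: divide_le_cancel)
    qed
    then show ?thesis by (auto simp: E_def deviation_event_def)
  qed
  have "(\<integral>x. f x * indicator (space M) x \<partial>M) = ?\<mu>"
    by (intro Bochner_Integration.integral_cong) auto
  then have "E \<in> sets (Pi\<^sub>M {..<n} (\<lambda>_. M)) \<and> measure (Pi\<^sub>M {..<n} (\<lambda>_. M)) E \<le> 2 * exp (- lam)"
    unfolding eq using n
    by (intro conjI deviation_event[OF M f f01 _ _ _ _ lam]) (auto simp: prob_space gr0_conv_Suc)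
  then show "E \<in> sets (Pi\<^sub>M {..<n} (\<lambda>_. M))" and "measure (Pi\<^sub>M {..<n} (\<lambda>_. M)) E \<le> 2 * exp (- lam)" by auto
qed

section \<open>The output of the algorithm\<close>

lemma argmin_timed_Some:
  assumes "as \<noteq> []"
  obtains b where "result (argmin_timed h as) = Some b" "b \<in> set as"
    "\<And>a. a \<in> set as \<Longrightarrow> result (h b) \<le> result (h a)"
proof -
  define upd where "upd a best = (case best of None \<Rightarrow> Some (a, result (h a))
      | Some (b, w) \<Rightarrow> if result (h a) < w then Some (a, result (h a)) else Some (b, w))" for a best
  \<comment> \<open>Invariant of the scan: the accumulator holds a minimizer of everything seen so
    far together with its own value. Starting from a stored pair instead of \<open>None\<close>
    makes the induction go through.\<close>
  have ind: "\<exists>b. fold upd as (Some (b0, result (h b0))) = Some (b, result (h b)) \<and> b \<in> insert b0 (set as) \<and>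
      (\<forall>a \<in> insert b0 (set as). result (h b) \<le> result (h a))" for b0 as
  proof (induction as arbitrary: b0)
    case (Cons a as)
    show ?case
    proof (cases "result (h a) < result (h b0)")
      case True
      with Cons[of a] show ?thesis by (auto simp: upd_def intro: order_trans)
    next
      case False
      with Cons[of b0] show ?thesis by (auto simp: upd_def intro: order_trans)
    qed
  qed simp
  have res: "result (argmin_timed h as) = map_option fst (fold upd as None)"
    by (simp add: argmin_timed_def upd_def[abs_def])
  obtain a as' where as: "as = a # as'" using assms by (cases as) auto
  obtain b where b: "fold upd as' (Some (a, result (h a))) = Some (b, result (h b))"
    "b \<in> insert a (set as')" "\<forall>a' \<in> insert a (set as'). result (h b) \<le> result (h a')"
    using ind[of as' a] by blast
  have "upd a None = Some (a, result (h a))" by (simp add: upd_def)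
  with b(1) as have "result (argmin_timed h as) = Some b" unfolding res by simp
  with b as show ?thesis by (intro that[of b]) auto
qed

lemma set_result_transfer_learner:
  "set (result (transfer_learner weight opt vals ins outs)) =
    {c. \<exists>P \<in> set (vals ins outs). result (opt ins outs (weight (length ins) (length outs)) P) = Some c}"
proof -
  have "set (fold (\<lambda>P cs. case h P of None \<Rightarrow> cs | Some c \<Rightarrow> c # cs) Ps cs) =
      {c. \<exists>P \<in> set Ps. h P = Some c} \<union> set cs" for h :: "real \<Rightarrow> 'a classifier option" and Ps cs
    by (induction Ps arbitrary: cs) (auto split: option.splits)
  then show ?thesis
    by (simp add: transfer_learner_def)
qed

lemma transfer_learner_in_class:
  assumes opt: "optimal_optimizer C opt" and weight: "weight (length ins) (length outs) \<in> {0..1}"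
    and c: "c \<in> set (result (transfer_learner weight opt vals ins outs))"
  shows "c \<in> C"
proof -
  from c obtain P where "result (opt ins outs (weight (length ins) (length outs)) P) = Some c"
    by (auto simp: set_result_transfer_learner)
  moreover have "case result (opt ins outs (weight (length ins) (length outs)) P) of
      None \<Rightarrow> rate_class C ins outs P = {}
    | Some c \<Rightarrow> is_arg_min (weighted_err (weight (length ins) (length outs)) ins outs) (\<lambda>c. c \<in> rate_class C ins outs P) c"
    using opt weight unfolding optimal_optimizer_def by blast
  ultimately show ?thesis by (simp add: is_arg_min_def rate_class_def)
qed

text \<open>One of the learner's runs uses the empirical rate of \<open>c\<close> itself as
  \<open>P\<close>. In that run \<open>c\<close> is feasible, so the optimizer cannot report
  \<open>None\<close>, and what it returns has the same rate and no larger weighted error.\<close>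

lemma transfer_learner_competes:
  assumes opt: "optimal_optimizer C opt" and weight: "weight (length ins) (length outs) \<in> {0..1}"
    and vals: "covers_rates C vals" and c: "c \<in> C"
  obtains c' where "c' \<in> set (result (transfer_learner weight opt vals ins outs))"
    "emp_rate ins outs c' = emp_rate ins outs c"
    "weighted_err (weight (length ins) (length outs)) ins outs c'
      \<le> weighted_err (weight (length ins) (length outs)) ins outs c"
proof -
  let ?\<theta> = "weight (length ins) (length outs)" and ?P = "emp_rate ins outs c"
  have c_mem: "c \<in> rate_class C ins outs ?P" using c by (simp add: rate_class_def)
  have *: "case result (opt ins outs ?\<theta> ?P) of None \<Rightarrow> rate_class C ins outs ?P = {}
    | Some c \<Rightarrow> is_arg_min (weighted_err ?\<theta> ins outs) (\<lambda>c. c \<in> rate_class C ins outs ?P) c"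
    using opt weight unfolding optimal_optimizer_def by blast
  then obtain c' where c': "result (opt ins outs ?\<theta> ?P) = Some c'"
    "is_arg_min (weighted_err ?\<theta> ins outs) (\<lambda>c. c \<in> rate_class C ins outs ?P) c'"
    using c_mem by (auto split: option.splits)
  show ?thesis
  proof (rule that)
    show "c' \<in> set (result (transfer_learner weight opt vals ins outs))"
      using c'(1) vals c unfolding set_result_transfer_learner covers_rates_def by blast
  qed (use c'(2) c_mem in \<open>auto simp: is_arg_min_linorder rate_class_def\<close>)
qed

abbreviation in_group :: "('x \<Rightarrow> nat) \<Rightarrow> nat \<Rightarrow> 'x sample \<Rightarrow> 'x sample" where
  "in_group g k \<equiv> filter (\<lambda>z. g (fst z) = k)"

abbreviation out_group :: "('x \<Rightarrow> nat) \<Rightarrow> nat \<Rightarrow> 'x sample \<Rightarrow> 'x sample" where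
  "out_group g k \<equiv> filter (\<lambda>z. g (fst z) \<noteq> k)"

text \<open>Translates the minimum over enumerated lists into a minimum over choice functions
  \<open>cs\<close>. List positions determine the arguments of \<open>L\<close> only on
  \<open>{1..K}\<close>, and \<open>L_cong\<close> allows replacing them by the functions in
  \<open>Lhat\<close>. Nonempty candidate sets guarantee that some tuple exists, hence that the
  output is not \<open>None\<close>.\<close>

lemma general_decouple_minimizes:
  fixes g :: "'x \<Rightarrow> nat" and weight :: "nat \<Rightarrow> nat \<Rightarrow> real" and opt :: "'x optimizer"
    and vals :: "'x rate_values" and zs :: "'x sample" and L :: joint_loss
  defines "Ck \<equiv> \<lambda>k. set (result (transfer_learner weight opt vals (in_group g k zs) (out_group g k zs)))"
  defines "Lhat \<equiv> \<lambda>cs. L (\<lambda>k. avg_err (in_group g k zs) (cs k)) (\<lambda>k. emp_rate (in_group g k zs) (out_group g k zs) (cs k))"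
  assumes L_cong: "\<And>l l' p p'. (\<And>k. k \<in> {1..K} \<Longrightarrow> l k = l' k \<and> p k = p' k \<and> l' k \<in> {0..1} \<and> p' k \<in> {0..1}) \<Longrightarrow> L l p = L l' p'"
    and unit: "\<And>k c. k \<in> {1..K} \<Longrightarrow> c \<in> Ck k \<Longrightarrow> avg_err (in_group g k zs) c \<in> {0..1} \<and> emp_rate (in_group g k zs) (out_group g k zs) c \<in> {0..1}"
    and nonempty: "\<And>k. k \<in> {1..K} \<Longrightarrow> Ck k \<noteq> {}"
  obtains cs where "result (general_decouple K g L weight opt vals zs) = Some (decoupled g cs)"
    "\<And>k. k \<in> {1..K} \<Longrightarrow> cs k \<in> Ck k"
    "\<And>cs'. (\<And>k. k \<in> {1..K} \<Longrightarrow> cs' k \<in> Ck k) \<Longrightarrow> Lhat cs \<le> Lhat cs'"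
proof -
  define entry where "entry k c = (c, avg_err (in_group g k zs) c, emp_rate (in_group g k zs) (out_group g k zs) c)" for k c
  define tables where "tables = map (\<lambda>k. map (entry k) (result (transfer_learner weight opt vals (in_group g k zs) (out_group g k zs)))) [1..<K + 1]"
  have res: "result (general_decouple K g L weight opt vals zs) =
      map_option (\<lambda>t. decoupled g (\<lambda>k. fst (t ! (k - 1)))) (result (argmin_timed (tuple_loss_timed K L) (result (tuples_timed tables))))"
    by (simp add: general_decouple_def tables_def entry_def[abs_def] result_estimate_timed del: upt_Suc)
  have tuple_iff: "t \<in> set (result (tuples_timed tables)) \<longleftrightarrow>
      length t = K \<and> (\<forall>k \<in> {1..K}. t ! (k - 1) \<in> entry k ` Ck k)" for t
  proof -
    have "t \<in> set (result (tuples_timed tables)) \<longleftrightarrow> length t = K \<and> (\<forall>i < K. t ! i \<in> entry (Suc i) ` Ck (Suc i))"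
      by (auto simp: set_result_tuples_timed product_lists_set list_all2_conv_all_nth tables_def Ck_def simp del: upt_Suc)
    also have "(\<forall>i < K. t ! i \<in> entry (Suc i) ` Ck (Suc i)) \<longleftrightarrow> (\<forall>k \<in> {1..K}. t ! (k - 1) \<in> entry k ` Ck k)"
    proof safe
      fix k assume "\<forall>i < K. t ! i \<in> entry (Suc i) ` Ck (Suc i)" "k \<in> {1..K}"
      then show "t ! (k - 1) \<in> entry k ` Ck k" by (cases k) auto
    next
      fix i assume "\<forall>k \<in> {1..K}. t ! (k - 1) \<in> entry k ` Ck k" "i < K"
      then show "t ! i \<in> entry (Suc i) ` Ck (Suc i)" by (force dest: bspec[of _ _ "Suc i"])
    qed
    finally show ?thesis .
  qed
  define tuple where "tuple cs = map (\<lambda>k. entry k (cs k)) [1..<K + 1]" for cs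
  have tuple_nth: "tuple cs ! (k - 1) = entry k (cs k)" if "k \<in> {1..K}" for cs k
    using that by (auto simp: tuple_def simp del: upt_Suc)
  have tuple_mem: "tuple cs \<in> set (result (tuples_timed tables))" if "\<And>k. k \<in> {1..K} \<Longrightarrow> cs k \<in> Ck k" for cs
    using that tuple_nth unfolding tuple_iff by (auto simp: tuple_def simp del: upt_Suc)
  \<comment> \<open>Outside \<open>{1..K}\<close> the two argument functions may disagree; this is
    where \<open>L_cong\<close> enters.\<close>
  have loss: "result (tuple_loss_timed K L t) = Lhat cs"
    if "\<And>k. k \<in> {1..K} \<Longrightarrow> t ! (k - 1) = entry k (cs k) \<and> cs k \<in> Ck k" for t cs
    unfolding tuple_loss_timed_def Lhat_def timed.sel
    using that unit by (intro L_cong) (auto simp: entry_def)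
  have "\<exists>cs. \<forall>k\<in>{1..K}. cs k \<in> Ck k"
    using nonempty by (intro bchoice) blast
  then obtain cs0 where "\<And>k. k \<in> {1..K} \<Longrightarrow> cs0 k \<in> Ck k" by blast
  then have "result (tuples_timed tables) \<noteq> []" using tuple_mem[of cs0] by auto
  then obtain t where t: "result (argmin_timed (tuple_loss_timed K L) (result (tuples_timed tables))) = Some t"
    "t \<in> set (result (tuples_timed tables))"
    "\<And>t'. t' \<in> set (result (tuples_timed tables)) \<Longrightarrow> result (tuple_loss_timed K L t) \<le> result (tuple_loss_timed K L t')"
    using argmin_timed_Some[of "result (tuples_timed tables)" "tuple_loss_timed K L"] by blast
  define cs where "cs k = fst (t ! (k - 1))" for k
  have cs: "t ! (k - 1) = entry k (cs k) \<and> cs k \<in> Ck k" if "k \<in> {1..K}" for k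
  proof -
    have "t ! (k - 1) \<in> entry k ` Ck k" using t(2) that tuple_iff by blast
    then show ?thesis by (auto simp: cs_def entry_def)
  qed
  show ?thesis
  proof (rule that)
    show "result (general_decouple K g L weight opt vals zs) = Some (decoupled g cs)"
      by (simp add: res t(1) cs_def[abs_def])
    show "cs k \<in> Ck k" if "k \<in> {1..K}" for k using cs[OF that] ..
    show "Lhat cs \<le> Lhat cs'" if cs': "\<And>k. k \<in> {1..K} \<Longrightarrow> cs' k \<in> Ck k" for cs'
      using t(3)[OF tuple_mem[of cs', OF cs']] loss[of t cs, OF cs] loss[of "tuple cs'" cs'] tuple_nth cs' by simp
  qed
qed

section \<open>Stability of the joint loss\<close>

text \<open>Monotonicity concerns one coordinate at a time, so the coordinates are raised one after
  another, by induction on the set of those already raised.\<close>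

lemma monotonic_loss_mono:
  assumes L: "monotonic_loss K L"
    and l: "l \<in> {1..K} \<rightarrow> {0..1}" and l': "l' \<in> {1..K} \<rightarrow> {0..1}" and p: "p \<in> {1..K} \<rightarrow> {0..1}"
    and le: "\<And>k. k \<in> {1..K} \<Longrightarrow> l k \<le> l' k"
  shows "L l p \<le> L (\<lambda>k. if k \<in> {1..K} then l' k else l k) p"
proof -
  have "L l p \<le> L (\<lambda>k. if k \<in> F then l' k else l k) p" if "finite F" "F \<subseteq> {1..K}" for F
    using that
  proof (induction F)
    case (insert j F)
    let ?m = "\<lambda>k. if k \<in> F then l' k else l k"
    have "L ?m p \<le> L (?m(j := l' j)) p"
      using L l l' p le insert unfolding monotonic_loss_def by (auto simp: Pi_iff)
    also have "?m(j := l' j) = (\<lambda>k. if k \<in> insert j F then l' k else l k)" by auto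
    finally show ?case using insert by simp
  qed simp
  from this[of "{1..K}"] show ?thesis by simp
qed

lemma continuous_loss_cong:
  assumes L: "continuous_loss K \<nu> R L"
    and eq: "\<And>k. k \<in> {1..K} \<Longrightarrow> l k = l' k \<and> p k = p' k \<and> l' k \<in> {0..1} \<and> p' k \<in> {0..1}"
  shows "L l p = L l' p'"
proof -
  have "\<bar>L l p - L l' p'\<bar> \<le> R * (\<Sum>k = 1..K. \<nu> k * \<bar>l k - l' k\<bar> + \<bar>p k - p' k\<bar>)"
  proof -
    have "l \<in> {1..K} \<rightarrow> {0..1}" "l' \<in> {1..K} \<rightarrow> {0..1}" "p \<in> {1..K} \<rightarrow> {0..1}" "p' \<in> {1..K} \<rightarrow> {0..1}"
      using eq by fastforce+
    with L show ?thesis unfolding continuous_loss_def by blast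
  qed
  also have "(\<Sum>k = 1..K. \<nu> k * \<bar>l k - l' k\<bar> + \<bar>p k - p' k\<bar>) = 0"
    using eq by (intro sum.neutral) auto
  finally show ?thesis by simp
qed

lemma continuous_loss_le:
  assumes L: "continuous_loss K \<nu> R L" and R: "0 \<le> R"
    and "l \<in> {1..K} \<rightarrow> {0..1}" "l' \<in> {1..K} \<rightarrow> {0..1}" "p \<in> {1..K} \<rightarrow> {0..1}" "p' \<in> {1..K} \<rightarrow> {0..1}"
    and bound: "\<And>k. k \<in> {1..K} \<Longrightarrow> \<nu> k * \<bar>l k - l' k\<bar> + \<bar>p k - p' k\<bar> \<le> b k"
  shows "\<bar>L l p - L l' p'\<bar> \<le> R * (\<Sum>k = 1..K. b k)"
proof -
  have "\<bar>L l p - L l' p'\<bar> \<le> R * (\<Sum>k = 1..K. \<nu> k * \<bar>l k - l' k\<bar> + \<bar>p k - p' k\<bar>)"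
    using assms unfolding continuous_loss_def by blast
  also have "\<dots> \<le> R * (\<Sum>k = 1..K. b k)"
    using R bound by (intro mult_left_mono sum_mono)
  finally show ?thesis .
qed

text \<open>The deterministic core of the guarantee. Suffix \<open>o\<close> stands for the output,
  \<open>t\<close> for the competitor produced by the learners, no suffix for the target classifier;
  primes mark empirical values. The chain runs from output to empirical output, to empirical
  competitor, to competitor, to target; monotonicity is used only in the last link.\<close>

lemma joint_loss_chain:
  fixes \<tau> :: real
  assumes L: "monotonic_loss K L" "continuous_loss K \<nu> R L" "0 \<le> R"
    and unit: "lo \<in> {1..K} \<rightarrow> {0..1}" "po \<in> {1..K} \<rightarrow> {0..1}" "lo' \<in> {1..K} \<rightarrow> {0..1}" "po' \<in> {1..K} \<rightarrow> {0..1}"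
      "lt \<in> {1..K} \<rightarrow> {0..1}" "pt \<in> {1..K} \<rightarrow> {0..1}" "lt' \<in> {1..K} \<rightarrow> {0..1}" "pt' \<in> {1..K} \<rightarrow> {0..1}"
      "l \<in> {1..K} \<rightarrow> {0..1}" "p \<in> {1..K} \<rightarrow> {0..1}"
    and emp: "L lo' po' \<le> L lt' pt'"
    and conc: "\<And>k. k \<in> {1..K} \<Longrightarrow> \<nu> k * \<bar>lo k - lo' k\<bar> \<le> \<tau> \<and> \<bar>po k - po' k\<bar> \<le> \<tau> / 2 \<and>
        \<nu> k * \<bar>lt k - lt' k\<bar> \<le> \<tau> \<and> \<bar>pt k - pt' k\<bar> \<le> \<tau> / 2"
    and transfer: "\<And>k. k \<in> {1..K} \<Longrightarrow> \<nu> k * max 0 (lt k - l k) \<le> \<tau> + m k \<and> \<bar>pt k - p k\<bar> \<le> \<tau>"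
  shows "L lo po \<le> L l p + 5 * R * real K * \<tau> + R * (\<Sum>k = 1..K. m k)"
proof -
  \<comment> \<open>The competitor's excess loss is controlled from above only. Raising its losses
    to this maximum does not decrease \<open>L\<close>, and the distance from the maximum to
    \<open>l\<close> is the positive part of the excess.\<close>
  let ?u = "\<lambda>k. max (lt k) (l k)"
  let ?u' = "\<lambda>k. if k \<in> {1..K} then ?u k else lt k"
  have "\<bar>L lo po - L lo' po'\<bar> \<le> R * (\<Sum>k = 1..K. 3 / 2 * \<tau>)"
  proof (rule continuous_loss_le[OF L(2,3)])
    show "\<nu> k * \<bar>lo k - lo' k\<bar> + \<bar>po k - po' k\<bar> \<le> 3 / 2 * \<tau>" if "k \<in> {1..K}" for k
      using conc[OF that] by linarith
  qed (fact unit)+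
  moreover have "\<bar>L lt pt - L lt' pt'\<bar> \<le> R * (\<Sum>k = 1..K. 3 / 2 * \<tau>)"
  proof (rule continuous_loss_le[OF L(2,3)])
    show "\<nu> k * \<bar>lt k - lt' k\<bar> + \<bar>pt k - pt' k\<bar> \<le> 3 / 2 * \<tau>" if "k \<in> {1..K}" for k
      using conc[OF that] by linarith
  qed (fact unit)+
  moreover have "L lt pt \<le> L ?u' pt"
    using unit by (intro monotonic_loss_mono[OF L(1)]) (auto simp: Pi_iff max_def)
  moreover have "\<bar>L ?u' pt - L l p\<bar> \<le> R * (\<Sum>k = 1..K. 2 * \<tau> + m k)"
  proof (rule continuous_loss_le[OF L(2,3)])
    fix k assume k: "k \<in> {1..K}"
    have "\<bar>?u' k - l k\<bar> = max 0 (lt k - l k)" using k by auto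
    with transfer[OF k] show "\<nu> k * \<bar>?u' k - l k\<bar> + \<bar>pt k - p k\<bar> \<le> 2 * \<tau> + m k" by simp
  qed (use unit in \<open>auto simp: Pi_iff max_def\<close>)
  ultimately have "L lo po \<le> L l p + R * (\<Sum>k = 1..K. 3 / 2 * \<tau>) + R * (\<Sum>k = 1..K. 3 / 2 * \<tau>) + R * (\<Sum>k = 1..K. 2 * \<tau> + m k)"
    using emp by linarith
  then show ?thesis by (simp add: sum.distrib algebra_simps)
qed

text \<open>At \<theta> = 1 all n examples are used at full bias, which gives \<tau> + \<Delta>. At
  \<theta> = 0 only in-group examples count, which gives \<tau> divided by the square root of a / n.
  The minimizing weight is at least as good as both; for \<nu> \<le> \<tau> only the first
  comparison is made.\<close>

lemma transfer_bound_optimal: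
  fixes \<Delta> \<delta> :: real
  assumes weight: "optimal_weight m \<Delta> (\<delta> / (4 * real (n + K))) n weight"
    and ab: "a + b = n" and n: "0 < n" and \<Delta>: "0 \<le> \<Delta>" and lam: "0 \<le> ln (8 * real m * real (n + K) / \<delta>)"
    and \<nu>: "\<bar>real a / real n - \<nu>\<bar> \<le> deviation m K n \<delta> / 2"
  shows "transfer_bound m \<Delta> (\<delta> / (4 * real (n + K))) a b (weight a b)
    \<le> deviation m K n \<delta> + transfer_term (deviation m K n \<delta>) \<Delta> \<nu>"
proof -
  define \<tau> where "\<tau> = deviation m K n \<delta>"
  define lam where "lam = ln (8 * real m * real (n + K) / \<delta>)"
  let ?f = "transfer_bound m \<Delta> (\<delta> / (4 * real (n + K))) a b"
  have \<tau>: "\<tau> = sqrt (2 / real n * lam)" by (simp add: \<tau>_def deviation_def lam_def)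
  have lam0: "0 \<le> lam" using lam by (simp add: lam_def)
  have \<tau>0: "0 \<le> \<tau>" using lam0 by (simp add: \<tau>)
  have log: "ln (2 * real m / (\<delta> / (4 * real (n + K)))) = lam" by (simp add: lam_def algebra_simps)
  have min: "?f (weight a b) \<le> ?f \<theta>" if "0 \<le> \<theta>" "\<theta> \<le> 1" "a = 0 \<Longrightarrow> 0 < \<theta>" for \<theta>
    using weight ab that unfolding optimal_weight_def is_arg_min_linorder by blast
  have "?f 1 = sqrt (2 * real n * lam) / real n + real b / real n * \<Delta>"
    using ab n unfolding transfer_bound_def log by (simp add: add_divide_distrib flip: of_nat_add)
  also have "sqrt (2 * real n * lam) / real n = \<tau>"
    using n by (simp add: \<tau> real_sqrt_divide real_sqrt_mult real_div_sqrt field_simps)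
  also have "real b / real n * \<Delta> \<le> 1 * \<Delta>"
    using ab n \<Delta> by (intro mult_right_mono) auto
  finally have one: "?f (weight a b) \<le> \<tau> + \<Delta>" using min[of 1] by simp
  have zero: "?f (weight a b) \<le> \<tau> * sqrt (1 / (\<nu> - \<tau>))" if "\<tau> < \<nu>"
  proof -
    \<comment> \<open>With \<tau> < \<nu> this forces a > 0, without which \<theta> = 0 would not be
      an admissible weight.\<close>
    have frac: "\<nu> - \<tau> \<le> real a / real n" using \<nu>[folded \<tau>_def] \<tau>0 by linarith
    with that have "0 < real a / real n" by linarith
    then have a0: "0 < a" using n by (simp add: zero_less_divide_iff)
    have "?f 0 = sqrt (2 * real a * lam) / real a" unfolding transfer_bound_def log by simp
    also have "\<dots> = \<tau> * sqrt (1 / (real a / real n))"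
      using a0 n by (simp add: \<tau> real_sqrt_divide real_sqrt_mult real_div_sqrt field_simps)
    also have "\<dots> \<le> \<tau> * sqrt (1 / (\<nu> - \<tau>))"
      using \<tau>0 that frac a0 n by (intro mult_left_mono real_sqrt_le_mono divide_left_mono) auto
    finally show ?thesis using min[of 0] a0 by simp
  qed
  show ?thesis
    using one zero \<tau>0 by (auto simp: transfer_term_def \<tau>_def[symmetric] min_def)
qed

section \<open>Running time\<close>

lemma steps_bind_timed [simp]: "steps (bind_timed m h) = steps m + steps (h (result m))"
  and steps_return_timed [simp]: "steps (return_timed a) = 0"
  and steps_step [simp]: "steps (step a) = 1"
  by (simp_all add: bind_timed_def return_timed_def step_def)

lemma steps_fold_timed:
  assumes "\<And>a s. a \<in> set as \<Longrightarrow> steps (h a s) \<le> B"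
  shows "steps (fold_timed h as s) \<le> length as * (B + 1) + 1"
  using assms
proof (induction as arbitrary: s)
  case (Cons a as)
  have "steps (h a s) \<le> B" using Cons.prems by simp
  moreover have "steps (fold_timed h as (result (h a s))) \<le> length as * (B + 1) + 1"
    using Cons by simp
  ultimately show ?case by simp
qed simp

lemma steps_map_timed:
  assumes "\<And>a. a \<in> set as \<Longrightarrow> steps (h a) \<le> B"
  shows "steps (map_timed h as) \<le> length as * (B + 1) + 1"
  using assms
proof (induction as)
  case (Cons a as)
  have "steps (h a) \<le> B" using Cons.prems by simp
  moreover have "steps (map_timed h as) \<le> length as * (B + 1) + 1" using Cons by simp
  ultimately show ?case by simp
qed simp

lemma steps_filter_timed: "steps (filter_timed Q as) = length as + 1"
  by (induction as) simp_all

lemma steps_length_timed: "steps (length_timed as) \<le> length as + 1"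
  using steps_fold_timed[of as "\<lambda>_ m. return_timed (Suc m)" 0 0] by (simp add: length_timed_def)

lemma steps_sum_timed: "steps (sum_timed h as) \<le> length as + 1"
  using steps_fold_timed[of as "\<lambda>a s. return_timed (s + h a)" 0 0] by (simp add: sum_timed_def)

lemma length_result_tuples_timed:
  assumes "\<And>as. as \<in> set ass \<Longrightarrow> length as \<le> N"
  shows "length (result (tuples_timed ass)) \<le> N ^ length ass"
  using assms
proof (induction ass)
  case (Cons as ass)
  have inner: "length (fold (\<lambda>t acc'. (a # t) # acc') ts acc) = length ts + length acc"
    for a :: 'a and ts acc by (induction ts arbitrary: acc) auto
  have "length (fold (\<lambda>a acc. fold (\<lambda>t acc'. (a # t) # acc') ts acc) as acc) = length as * length ts + length acc"
    for ts :: "'a list list" and acc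
    by (induction as arbitrary: acc) (auto simp: inner)
  moreover have "length as \<le> N" "length (result (tuples_timed ass)) \<le> N ^ length ass"
    using Cons by simp_all
  ultimately show ?case by (simp add: mult_le_mono)
qed simp

text \<open>Every list, and also the empty tail, is charged the cost of the most expensive
  extension; \<open>1 \<le> N\<close> makes the charge grow with the number of lists.\<close>

lemma steps_tuples_timed:
  assumes "\<And>as. as \<in> set ass \<Longrightarrow> length as \<le> N" and "1 \<le> N"
  shows "steps (tuples_timed ass) \<le> (length ass + 1) * (N * (N ^ length ass + 2) + 1)"
  using assms(1)
proof (induction ass)
  case (Cons as ass)
  let ?ts = "result (tuples_timed ass)"
  let ?B = "\<lambda>m. N * (N ^ m + 2) + 1"
  have "length ?ts \<le> N ^ length ass" using Cons.prems by (intro length_result_tuples_timed) auto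
  then have inner: "steps (fold_timed (\<lambda>t acc'. return_timed ((a # t) # acc')) ?ts acc) \<le> N ^ length ass + 1" for a acc
    using steps_fold_timed[of ?ts "\<lambda>t acc'. return_timed ((a # t) # acc')" 0 acc] by simp
  have "steps (fold_timed (\<lambda>a acc. fold_timed (\<lambda>t acc'. return_timed ((a # t) # acc')) ?ts acc) as []) \<le>
      length as * (N ^ length ass + 1 + 1) + 1"
    by (intro steps_fold_timed inner)
  also have "\<dots> \<le> ?B (length ass)"
    using mult_le_mono1[of "length as" N "N ^ length ass + 2"] Cons.prems by simp
  finally have outer: "steps (fold_timed (\<lambda>a acc. fold_timed (\<lambda>t acc'. return_timed ((a # t) # acc')) ?ts acc) as []) \<le> ?B (length ass)" .
  have "steps (tuples_timed (as # ass)) \<le> (length ass + 1) * ?B (length ass) + ?B (length ass)"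
    using outer Cons by (simp del: length_Cons)
  also have "\<dots> = (length ass + 2) * ?B (length ass)" by (simp add: algebra_simps)
  also have "\<dots> \<le> (length ass + 2) * ?B (Suc (length ass))"
    using \<open>1 \<le> N\<close> by (intro mult_le_mono add_mono order_refl) auto
  finally show ?case by simp
qed simp

lemma steps_argmin_timed:
  assumes "\<And>a. a \<in> set as \<Longrightarrow> steps (h a) \<le> B"
  shows "steps (argmin_timed h as) \<le> length as * (B + 1) + 2"
proof -
  have "steps (fold_timed (\<lambda>a best. bind_timed (h a) (\<lambda>v. return_timed (case best of None \<Rightarrow> Some (a, v)
      | Some (b, w) \<Rightarrow> if v < w then Some (a, v) else Some (b, w)))) as None) \<le> length as * (B + 1) + 1"
    using assms by (intro steps_fold_timed) auto
  then show ?thesis by (simp add: argmin_timed_def)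
qed

text \<open>The optimizer is called once per listed rate, and \<open>few_rates\<close> limits both
  these calls and the classifiers they return to one more than the in-group examples.\<close>

lemma steps_transfer_learner:
  assumes opt: "optimizer_time opt (length ins + length outs) t"
    and weight: "weight (length ins) (length outs) \<in> {0..1}" and vals: "few_rates vals"
  shows "steps (transfer_learner weight opt vals ins outs) \<le> (length ins + length outs + 1) * (t + 1) + length ins + length outs + 4"
    and "length (result (transfer_learner weight opt vals ins outs)) \<le> length ins + 1"
proof -
  let ?\<theta> = "weight (length ins) (length outs)"
  let ?h = "\<lambda>P cs. bind_timed (opt ins outs ?\<theta> P) (\<lambda>r. return_timed (case r of None \<Rightarrow> cs | Some c \<Rightarrow> c # cs))"
  have len: "length (vals ins outs) \<le> length ins + 1" using vals by (simp add: few_rates_def)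
  have "steps (fold_timed ?h (vals ins outs) []) \<le> length (vals ins outs) * (t + 1) + 1"
    using opt weight by (intro steps_fold_timed) (auto simp: optimizer_time_def)
  also have "\<dots> \<le> (length ins + length outs + 1) * (t + 1) + 1"
    using len by (intro add_mono mult_le_mono) auto
  finally show "steps (transfer_learner weight opt vals ins outs) \<le> (length ins + length outs + 1) * (t + 1) + length ins + length outs + 4"
    using steps_length_timed[of ins] steps_length_timed[of outs] by (simp add: transfer_learner_def)
  have "length (fold (\<lambda>P cs. case h P of None \<Rightarrow> cs | Some c \<Rightarrow> c # cs) Ps cs) \<le> length Ps + length cs"
    for h :: "real \<Rightarrow> 'a classifier option" and Ps cs
  proof (induction Ps arbitrary: cs)
    case (Cons P Ps)
    show ?case
      using Cons[of cs] Cons[of "the (h P) # cs"] by (auto split: option.splits)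
  qed simp
  from this[of "\<lambda>P. result (opt ins outs ?\<theta> P)" "vals ins outs" "[]"] len
  show "length (result (transfer_learner weight opt vals ins outs)) \<le> length ins + 1"
    by (simp add: transfer_learner_def)
qed

lemma steps_estimate_timed: "steps (estimate_timed ins outs c) \<le> 4 * (length ins + length outs + 1) + 1"
  using steps_length_timed[of ins] steps_length_timed[of outs]
    steps_sum_timed[of "\<lambda>(x, y). \<bar>of_bool y - c x\<bar>" ins] steps_sum_timed[of "\<lambda>(x, y). c x" ins]
  by (simp add: estimate_timed_def)

text \<open>The summands are the learning and estimation for the K groups, the enumeration of
  tuples, the search for the best tuple, and the final step. Each table has at most n + 1 entries,
  so there are at most (n + 1)^K tuples; only here does K appear as an exponent.\<close>

lemma steps_general_decouple:
  fixes zs :: "'x sample" and t :: nat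
  defines "n \<equiv> length zs"
  defines "group_steps \<equiv> (n + 1) * (t + 1) + 3 * n + 6 + ((n + 1) * (4 * (n + 1) + 2) + 1)"
  assumes weight: "\<And>a b. a + b = n \<Longrightarrow> weight a b \<in> {0..1}" and vals: "few_rates vals"
    and opt: "optimizer_time opt n t"
  shows "steps (general_decouple K g L weight opt vals zs) \<le>
    (K * (group_steps + 1) + 1) + (K + 1) * ((n + 1) * ((n + 1) ^ K + 2) + 1) + ((n + 1) ^ K * (K + 2) + 2) + 1"
proof -
  let ?ins = "\<lambda>k. filter (\<lambda>z. g (fst z) = k) zs" and ?outs = "\<lambda>k. filter (\<lambda>z. g (fst z) \<noteq> k) zs"
  let ?body = "\<lambda>k. bind_timed (filter_timed (\<lambda>z. g (fst z) = k) zs) (\<lambda>ins.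
     bind_timed (filter_timed (\<lambda>z. g (fst z) \<noteq> k) zs) (\<lambda>outs.
     bind_timed (transfer_learner weight opt vals ins outs) (\<lambda>cs. map_timed (estimate_timed ins outs) cs)))"
  have len: "length (?ins k) + length (?outs k) = n" for k
    unfolding n_def using sum_length_filter_compl[of "\<lambda>z. g (fst z) = k" zs] by simp
  have w: "weight (length (?ins k)) (length (?outs k)) \<in> {0..1}" for k by (intro weight len)
  have opt': "optimizer_time opt (length (?ins k) + length (?outs k)) t" for k using opt len by simp
  have learner: "steps (transfer_learner weight opt vals (?ins k) (?outs k)) \<le> (n + 1) * (t + 1) + n + 4"
    "length (result (transfer_learner weight opt vals (?ins k) (?outs k))) \<le> length (?ins k) + 1" for k
    using steps_transfer_learner[where weight = weight and opt = opt and vals = vals and t = t and ins = "?ins k" and outs = "?outs k", OF opt'[of k] w[of k] vals] len[of k] by (auto simp: add.assoc)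
  have size: "length (result (?body k)) \<le> n + 1" for k
  proof -
    have "length (?ins k) \<le> n" by (simp add: n_def)
    with learner(2)[of k] show ?thesis by simp
  qed
  have body: "steps (?body k) \<le> group_steps" for k
  proof -
    let ?cs = "result (transfer_learner weight opt vals (?ins k) (?outs k))"
    have "steps (map_timed (estimate_timed (?ins k) (?outs k)) ?cs) \<le> length ?cs * (4 * (n + 1) + 1 + 1) + 1"
      using steps_estimate_timed[of "?ins k" "?outs k"] len by (intro steps_map_timed) simp
    also have "\<dots> \<le> (n + 1) * (4 * (n + 1) + 2) + 1"
      using mult_le_mono1[OF size[of k], of "4 * (n + 1) + 2"] by simp
    finally have est: "steps (map_timed (estimate_timed (?ins k) (?outs k)) ?cs) \<le> (n + 1) * (4 * (n + 1) + 2) + 1" .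
    have add: "n + 1 + (n + 1 + (s1 + s2)) \<le> 2 * (n + 1) + B1 + B2" if "s1 \<le> B1" "s2 \<le> B2" for s1 s2 B1 B2 :: nat
      using that by simp
    have "steps (?body k) \<le> 2 * (n + 1) + ((n + 1) * (t + 1) + n + 4) + ((n + 1) * (4 * (n + 1) + 2) + 1)"
      unfolding steps_bind_timed result_bind_timed steps_filter_timed result_filter_timed n_def[symmetric]
      by (intro add learner(1) est)
    then show ?thesis by (simp add: group_steps_def)
  qed
  let ?tables = "result (map_timed ?body [1..<K + 1])"
  have tables: "steps (map_timed ?body [1..<K + 1]) \<le> K * (group_steps + 1) + 1"
    using steps_map_timed[of "[1..<K + 1]" ?body group_steps, OF body] by (simp del: upt_Suc)
  have table_size: "length as \<le> n + 1" if "as \<in> set ?tables" for as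
    using that size by (auto simp del: upt_Suc)
  have length_tables: "length ?tables = K" by (simp del: upt_Suc)
  have tuples: "steps (tuples_timed ?tables) \<le> (K + 1) * ((n + 1) * ((n + 1) ^ K + 2) + 1)"
    using steps_tuples_timed[of ?tables "n + 1", OF table_size] unfolding length_tables by simp
  have "length (result (tuples_timed ?tables)) \<le> (n + 1) ^ K"
    using length_result_tuples_timed[of ?tables "n + 1", OF table_size] unfolding length_tables by simp
  moreover have "steps (argmin_timed (tuple_loss_timed K L) (result (tuples_timed ?tables))) \<le>
      length (result (tuples_timed ?tables)) * (K + 1 + 1) + 2"
    by (intro steps_argmin_timed) (simp add: tuple_loss_timed_def)
  ultimately have argmin: "steps (argmin_timed (tuple_loss_timed K L) (result (tuples_timed ?tables))) \<le> (n + 1) ^ K * (K + 2) + 2"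
    by (elim order_trans) (simp add: mult_le_mono1 del: mult_Suc_right)
  show ?thesis
    using tables tuples argmin unfolding general_decouple_def steps_bind_timed steps_step by linarith
qed

section \<open>Polynomials in the sample size and the optimizer time\<close>

text \<open>The outer variable of \<open>q\<close> is the optimizer time: substituting the constant
  polynomial \<open>[:t:]\<close> for it leaves a polynomial in the sample size, which is then
  evaluated at \<open>n\<close>.\<close>

definition bivariate_poly :: "(nat \<Rightarrow> nat \<Rightarrow> nat) \<Rightarrow> bool" where
  "bivariate_poly F \<longleftrightarrow> (\<exists>q :: nat poly poly. \<forall>n t. poly (poly q [:t:]) n = F n t)"

lemma bivariate_poly_const: "bivariate_poly (\<lambda>_ _. c)"
  unfolding bivariate_poly_def by (rule exI[of _ "[:[:c:]:]"]) simp

lemma bivariate_poly_fst: "bivariate_poly (\<lambda>n _. n)"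
  unfolding bivariate_poly_def by (rule exI[of _ "[:[:0, 1:]:]"]) simp

lemma bivariate_poly_snd: "bivariate_poly (\<lambda>_ t. t)"
  unfolding bivariate_poly_def by (rule exI[of _ "[:0, 1:]"]) simp

lemma bivariate_poly_add:
  assumes "bivariate_poly F" "bivariate_poly G"
  shows "bivariate_poly (\<lambda>n t. F n t + G n t)"
  using assms unfolding bivariate_poly_def by (metis poly_add)

lemma bivariate_poly_mult:
  assumes "bivariate_poly F" "bivariate_poly G"
  shows "bivariate_poly (\<lambda>n t. F n t * G n t)"
  using assms unfolding bivariate_poly_def by (metis poly_mult)

lemma bivariate_poly_power:
  assumes "bivariate_poly F"
  shows "bivariate_poly (\<lambda>n t. F n t ^ m)"
  by (induction m) (auto intro: bivariate_poly_const bivariate_poly_mult assms)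

text \<open>The polynomial is chosen before the groups, the loss, the optimizer and the sample, and
  depends on \<open>K\<close> alone. With \<open>K\<close> fixed, the explicit step bound is built
  from sums, products and constant powers.\<close>

lemma general_decouple_polynomial_time:
  "\<exists>q :: nat poly poly.
     \<forall>(g :: 'x \<Rightarrow> nat) L weight opt vals zs t.
       (\<forall>a b. a + b = length zs \<longrightarrow> weight a b \<in> {0..1}) \<longrightarrow> few_rates vals \<longrightarrow> optimizer_time opt (length zs) t \<longrightarrow>
       steps (general_decouple K g L weight opt vals zs) \<le> poly (poly q [:t:]) (length zs)"
proof -
  have "bivariate_poly (\<lambda>n t. (K * (((n + 1) * (t + 1) + 3 * n + 6 + ((n + 1) * (4 * (n + 1) + 2) + 1)) + 1) + 1)
      + (K + 1) * ((n + 1) * ((n + 1) ^ K + 2) + 1) + ((n + 1) ^ K * (K + 2) + 2) + 1)"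
    by (intro bivariate_poly_add bivariate_poly_mult bivariate_poly_power bivariate_poly_const
        bivariate_poly_fst bivariate_poly_snd)
  then obtain q :: "nat poly poly" where
    "\<And>n t. poly (poly q [:t:]) n = (K * (((n + 1) * (t + 1) + 3 * n + 6 + ((n + 1) * (4 * (n + 1) + 2) + 1)) + 1) + 1)
      + (K + 1) * ((n + 1) * ((n + 1) ^ K + 2) + 1) + ((n + 1) ^ K * (K + 2) + 2) + 1"
    unfolding bivariate_poly_def by blast
  then show ?thesis
    using steps_general_decouple[where K = K] by (intro exI[of _ q]) (simp only:, blast)
qed

section \<open>Typical samples\<close>

definition err :: "'x classifier \<Rightarrow> 'x \<times> bool \<Rightarrow> real" where
  "err c z = \<bar>of_bool (snd z) - c (fst z)\<bar>"

text \<open>The algorithm sees a list, the product measure a function on indices; this lemma and the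
  next pass between the two.\<close>

lemma sum_list_filter_map_upt:
  "(\<Sum>z \<leftarrow> filter Q (map S [0..<n]). h z) = (\<Sum>i<n. h (S i) * of_bool (Q (S i)))" for h :: "'a \<Rightarrow> real"
  by (induction n) auto

lemma length_filter_map_upt:
  "length (filter Q (map S [0..<n])) = card {i \<in> {..<n}. Q (S i)}"
proof -
  have "length (filter Q (map S [0..<n])) = card {i. i < n \<and> Q (map S [0..<n] ! i)}"
    unfolding length_filter_conv_card by simp
  also have "{i. i < n \<and> Q (map S [0..<n] ! i)} = {i \<in> {..<n}. Q (S i)}" by auto
  finally show ?thesis .
qed

lemma avg_err_eq: "avg_err zs c = (\<Sum>z \<leftarrow> zs. err c z) / real (length zs)"
  by (simp add: avg_err_def err_def case_prod_beta')

lemma length_mult_avg_err: "real (length zs) * avg_err zs c = (\<Sum>z \<leftarrow> zs. err c z)"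
  by (cases "zs = []") (simp_all add: avg_err_eq)

lemma sum_list_unit_interval:
  fixes h :: "'a \<Rightarrow> real"
  assumes "\<And>z. z \<in> set zs \<Longrightarrow> h z \<in> {0..1}"
  shows "(\<Sum>z \<leftarrow> zs. h z) \<in> {0..real (length zs)}"
  using assms by (induction zs) (auto simp: add_increasing intro: add_mono)

lemma avg_err_unit_interval:
  assumes "\<And>z. z \<in> set zs \<Longrightarrow> c (fst z) \<in> {0..1}"
  shows "avg_err zs c \<in> {0..1}"
proof -
  have "(\<Sum>z \<leftarrow> zs. err c z) \<in> {0..real (length zs)}"
    using assms by (intro sum_list_unit_interval) (fastforce simp: err_def of_bool_def)
  then show ?thesis by (auto simp: avg_err_eq divide_le_eq_1)
qed

lemma emp_rate_unit_interval:
  assumes "\<And>z. z \<in> set ins \<Longrightarrow> c (fst z) \<in> {0..1}"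
  shows "emp_rate ins outs c \<in> {0..1}"
proof -
  have "(\<Sum>z \<leftarrow> ins. c (fst z)) \<in> {0..real (length ins)}"
    using assms by (intro sum_list_unit_interval)
  then show ?thesis by (auto simp: emp_rate_def case_prod_beta' divide_le_eq_1)
qed

text \<open>Here l and r are in-group and out-group losses, and W is the weighted error with
  expected value a l + \<theta> b r. Moving from the unprimed to the primed classifier changes r by
  as much as l up to \<Delta>, so the expected weighted error changes by at least (a + \<theta>
  b)(l' - l) - \<theta> b \<Delta>, while concentration and W' \<le> W allow at most 2 s.\<close>

lemma transfer_excess:
  fixes l l' r r' \<theta> s W W' \<Delta> :: real
  assumes pos: "0 < real a + \<theta> * real b" and \<theta>: "0 \<le> \<theta>" and W: "W' \<le> W"
    and dev: "\<bar>W - (real a * l + \<theta> * real b * r)\<bar> \<le> s" "\<bar>W' - (real a * l' + \<theta> * real b * r')\<bar> \<le> s"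
    and \<Delta>: "\<bar>(r' - r) - (l' - l)\<bar> \<le> \<Delta>"
  shows "l' - l \<le> (2 * s + \<theta> * real b * \<Delta>) / (real a + \<theta> * real b)"
proof -
  have "(real a + \<theta> * real b) * (l' - l) = (real a * l' + \<theta> * real b * r') - (real a * l + \<theta> * real b * r)
      - \<theta> * real b * ((r' - r) - (l' - l))"
    by (simp add: algebra_simps)
  also have "\<dots> \<le> 2 * s + \<theta> * real b * \<Delta>"
  proof -
    have "- ((r' - r) - (l' - l)) \<le> \<Delta>" using \<Delta> by linarith
    then have "\<theta> * real b * - ((r' - r) - (l' - l)) \<le> \<theta> * real b * \<Delta>"
      using \<theta> by (intro mult_left_mono) auto
    then show ?thesis using dev W by linarith
  qed
  finally show ?thesis using pos by (simp add: pos_le_divide_eq mult.commute)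
qed

lemma transfer_term_nonneg: "0 \<le> \<tau> \<Longrightarrow> 0 \<le> \<Delta> \<Longrightarrow> 0 \<le> transfer_term \<tau> \<Delta> \<nu>"
  by (simp add: transfer_term_def)

text \<open>The value at \<open>\<nu>\<^sub>k = 1\<close> is irrelevant; this choice makes \<open>out_loss_shift\<close> hold there too.\<close>

definition out_loss :: "('x \<times> bool) measure \<Rightarrow> ('x \<Rightarrow> nat) \<Rightarrow> nat \<Rightarrow> 'x classifier \<Rightarrow> real" where
  "out_loss D g k c =
     (if group_prob D g k = 1 then true_loss D g k c
      else (\<integral>z. err c z * of_bool (g (fst z) \<noteq> k) \<partial>D) / (1 - group_prob D g k))"

section \<open>True losses inside and outside a group\<close>

locale grouped_examples = prob_space D
  for D :: "('x \<times> bool) measure" and X :: "'x measure" and g :: "'x \<Rightarrow> nat" and K :: nat +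
  assumes sets_D: "sets D = sets (X \<Otimes>\<^sub>M count_space UNIV)"
    and g_meas: "g \<in> measurable X (count_space {1..K})"
begin

definition unit_classifier :: "'x classifier \<Rightarrow> bool" where
  "unit_classifier c \<longleftrightarrow> c \<in> borel_measurable X \<and> c \<in> space X \<rightarrow> {0..1}"

definition group_event :: "nat \<Rightarrow> ('x \<times> bool) set" where
  "group_event k = {z \<in> space D. g (fst z) = k}"

lemma space_D: "space D = space X \<times> UNIV"
  using sets_eq_imp_space_eq[OF sets_D] by (simp add: space_pair_measure)

lemma measurable_D: "f \<in> measurable (X \<Otimes>\<^sub>M count_space UNIV) N \<Longrightarrow> f \<in> measurable D N"
  using measurable_cong_sets[OF sets_D refl, of N] by blast

lemma fst_meas [measurable]: "fst \<in> measurable D X"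
  and snd_meas [measurable]: "snd \<in> measurable D (count_space UNIV)"
  by (auto intro!: measurable_D)

lemma group_meas [measurable]: "(\<lambda>z. g (fst z)) \<in> measurable D (count_space UNIV)"
proof -
  have "g \<in> measurable X (count_space UNIV)"
    using measurable_compose[OF g_meas, of id "count_space UNIV"] by simp
  then show ?thesis using measurable_compose[OF fst_meas] by blast
qed

lemma group_range: "z \<in> space D \<Longrightarrow> g (fst z) \<in> {1..K}"
  using g_meas by (auto simp: space_D measurable_def)

lemma group_event_sets [measurable]: "group_event k \<in> sets D"
  unfolding group_event_def by measurable

lemma measure_group_event: "measure D (group_event k) = group_prob D g k"
  by (simp add: group_event_def group_prob_def)

lemma measure_group_event_compl: "measure D (space D - group_event k) = 1 - group_prob D g k"
  by (simp add: prob_compl measure_group_event)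

lemma indicator_group_event: "z \<in> space D \<Longrightarrow> indicator (group_event k) z = (of_bool (g (fst z) = k) :: real)"
  by (simp add: group_event_def)

lemma group_prob_unit: "group_prob D g k \<in> {0..1}"
  by (simp add: group_prob_def)

context
  fixes c :: "'x classifier"
  assumes c: "unit_classifier c"
begin

lemma classifier_meas [measurable]: "(\<lambda>z. c (fst z)) \<in> borel_measurable D"
  using c measurable_compose[OF fst_meas] by (auto simp: unit_classifier_def)

lemma err_meas [measurable]: "err c \<in> borel_measurable D"
proof -
  have [measurable]: "(\<lambda>z. of_bool (snd z) :: real) \<in> borel_measurable D"
    using measurable_compose[OF snd_meas, of of_bool borel] by simp
  show ?thesis unfolding err_def[abs_def] by measurable
qed

lemma classifier_unit: "z \<in> space D \<Longrightarrow> c (fst z) \<in> {0..1}"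
  using c by (auto simp: unit_classifier_def space_D)

lemma err_unit: "z \<in> space D \<Longrightarrow> err c z \<in> {0..1}"
  using classifier_unit[of z] by (auto simp: err_def of_bool_def)

lemma integrable_err: "integrable D (\<lambda>z. err c z * of_bool (Q (g (fst z))))"
  using err_unit by (intro integrable_const_bound[where B = 1]) (auto simp: abs_mult intro!: AE_I2)

text \<open>The product form avoids the division and holds for null groups too, where both sides are
  0. It supplies the in-group mean hypothesis of \<open>deviation_event\<close>.\<close>

lemma true_loss_mult: "(\<integral>z. err c z * of_bool (g (fst z) = k) \<partial>D) = true_loss D g k c * group_prob D g k"
proof (cases "group_prob D g k = 0")
  case True
  then have "group_event k \<in> null_sets D"
    by (simp add: null_sets_def emeasure_eq_measure measure_group_event)
  then have "AE z in D. z \<notin> group_event k" by (rule AE_not_in)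
  then have "(\<integral>z. err c z * of_bool (g (fst z) = k) \<partial>D) = (\<integral>z. 0 \<partial>D)"
    by (intro integral_cong_AE) (auto simp: group_event_def elim!: AE_mp)
  with True show ?thesis by simp
qed (simp add: true_loss_def err_def)

lemma true_loss_unit: "true_loss D g k c \<in> {0..1}"
proof (cases "group_prob D g k = 0")
  case False
  then have pos: "0 < group_prob D g k" using group_prob_unit[of k] by auto
  have "0 \<le> (\<integral>z. err c z * of_bool (g (fst z) = k) \<partial>D)"
    using err_unit by (intro integral_nonneg_AE) (auto intro!: AE_I2)
  moreover have "(\<integral>z. err c z * of_bool (g (fst z) = k) \<partial>D) \<le> (\<integral>z. indicator (group_event k) z \<partial>D)"
    using err_unit integrable_err[of "\<lambda>j. j = k"]
    by (intro integral_mono) (auto simp: indicator_group_event emeasure_eq_measure)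
  ultimately show ?thesis
    using pos by (simp add: true_loss_mult measure_group_event zero_le_mult_iff)
qed (simp add: true_loss_def)

lemma true_rate_unit: "true_rate D g k c \<in> {0..1}"
proof -
  have "0 \<le> true_rate D g k c" unfolding true_rate_def
    using classifier_unit by (intro integral_nonneg_AE) (auto intro!: AE_I2)
  moreover have "true_rate D g k c \<le> (\<integral>z. 1 \<partial>D)" unfolding true_rate_def
    using classifier_unit
    by (intro integral_mono integrable_const_bound[where B = 1]) (auto simp: abs_mult intro!: AE_I2)
  ultimately show ?thesis by (simp add: prob_space)
qed

lemma sum_group_loss:
  assumes k: "k \<in> {1..K}"
  shows "(\<integral>z. err c z * of_bool (g (fst z) \<noteq> k) \<partial>D) = (\<Sum>j \<in> {1..K} - {k}. true_loss D g j c * group_prob D g j)"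
proof -
  have "(\<integral>z. err c z * of_bool (g (fst z) \<noteq> k) \<partial>D) = (\<integral>z. (\<Sum>j \<in> {1..K} - {k}. err c z * of_bool (g (fst z) = j)) \<partial>D)"
  proof (rule Bochner_Integration.integral_cong[OF refl])
    fix z assume "z \<in> space D"
    from group_range[OF this] show "err c z * of_bool (g (fst z) \<noteq> k) = (\<Sum>j \<in> {1..K} - {k}. err c z * of_bool (g (fst z) = j))"
      by (simp add: of_bool_def sum_distrib_left[symmetric] sum.delta')
  qed
  also have "\<dots> = (\<Sum>j \<in> {1..K} - {k}. true_loss D g j c * group_prob D g j)"
    using integrable_err by (subst Bochner_Integration.integral_sum) (simp_all add: true_loss_mult)
  finally show ?thesis .
qed

text \<open>Counterpart of \<open>true_loss_mult\<close> for the complement of the group, again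
  covering a null complement.\<close>

lemma out_loss_mult:
  "(\<integral>z. err c z * indicator (space D - group_event k) z \<partial>D) = out_loss D g k c * measure D (space D - group_event k)"
proof -
  have eq: "(\<integral>z. err c z * indicator (space D - group_event k) z \<partial>D) = (\<integral>z. err c z * of_bool (g (fst z) \<noteq> k) \<partial>D)"
    by (intro Bochner_Integration.integral_cong) (auto simp: group_event_def)
  show ?thesis
  proof (cases "group_prob D g k = 1")
    case True
    then have "space D - group_event k \<in> null_sets D"
      using measure_group_event_compl[of k] by (simp add: null_sets_def emeasure_eq_measure)
    then have "AE z in D. z \<notin> space D - group_event k" by (rule AE_not_in)
    then have "(\<integral>z. err c z * indicator (space D - group_event k) z \<partial>D) = (\<integral>z. 0 \<partial>D)"
      by (intro integral_cong_AE) (auto elim!: AE_mp)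
    with True show ?thesis by (simp add: measure_group_event_compl)
  next
    case False
    then show ?thesis by (simp add: eq out_loss_def measure_group_event_compl)
  qed
qed

end

lemma sum_group_prob:
  assumes "k \<in> {1..K}"
  shows "(\<Sum>j \<in> {1..K} - {k}. group_prob D g j) = 1 - group_prob D g k"
proof -
  have "(\<Sum>j \<in> {1..K} - {k}. measure D (group_event j)) = measure D (\<Union>j \<in> {1..K} - {k}. group_event j)"
    by (intro finite_measure_finite_Union[symmetric]) (auto simp: disjoint_family_on_def group_event_def)
  also have "(\<Union>j \<in> {1..K} - {k}. group_event j) = space D - group_event k"
    using group_range by (auto simp: group_event_def)
  finally show ?thesis by (simp add: measure_group_event measure_group_event_compl)
qed

text \<open>The out-group loss is the average of the losses of the other groups with weights
  proportional to their probabilities. Hence the pairwise bound \<Delta> passes to the average. If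
  group \<open>k\<close> has probability 1, the convention in \<open>out_loss\<close> makes the
  difference 0.\<close>

lemma out_loss_shift:
  assumes k: "k \<in> {1..K}" and c: "unit_classifier c" and c': "unit_classifier c'" and \<Delta>0: "0 \<le> \<Delta>"
    and \<Delta>: "\<And>j. j \<in> {1..K} \<Longrightarrow>
      \<bar>(true_loss D g j c - true_loss D g j c') - (true_loss D g k c - true_loss D g k c')\<bar> \<le> \<Delta>"
  shows "\<bar>(out_loss D g k c - out_loss D g k c') - (true_loss D g k c - true_loss D g k c')\<bar> \<le> \<Delta>"
proof (cases "group_prob D g k = 1")
  case True
  then show ?thesis using \<Delta>0 by (simp add: out_loss_def)
next
  case False
  let ?\<nu> = "group_prob D g" and ?d = "\<lambda>j. true_loss D g j c - true_loss D g j c'"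
  have pos: "0 < 1 - ?\<nu> k" using False group_prob_unit[of k] by auto
  have "(1 - ?\<nu> k) * ((out_loss D g k c - out_loss D g k c') - ?d k) =
      (\<Sum>j \<in> {1..K} - {k}. true_loss D g j c * ?\<nu> j) - (\<Sum>j \<in> {1..K} - {k}. true_loss D g j c' * ?\<nu> j) - (1 - ?\<nu> k) * ?d k"
    using pos by (simp add: out_loss_def False sum_group_loss[OF c k] sum_group_loss[OF c' k] right_diff_distrib)
  also have "\<dots> = (\<Sum>j \<in> {1..K} - {k}. ?\<nu> j * (?d j - ?d k))"
    unfolding sum_group_prob[OF k, symmetric] sum_distrib_right sum_subtractf[symmetric]
    by (intro sum.cong) (auto simp: algebra_simps)
  finally have eq: "(1 - ?\<nu> k) * ((out_loss D g k c - out_loss D g k c') - ?d k) = (\<Sum>j \<in> {1..K} - {k}. ?\<nu> j * (?d j - ?d k))" .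
  have "\<bar>\<Sum>j \<in> {1..K} - {k}. ?\<nu> j * (?d j - ?d k)\<bar> \<le> (\<Sum>j \<in> {1..K} - {k}. ?\<nu> j * \<Delta>)"
  proof (rule order_trans[OF sum_abs sum_mono])
    fix j assume "j \<in> {1..K} - {k}"
    then show "\<bar>?\<nu> j * (?d j - ?d k)\<bar> \<le> ?\<nu> j * \<Delta>"
      using \<Delta>[of j] group_prob_unit[of j] by (auto simp: abs_mult intro!: mult_left_mono)
  qed
  also have "\<dots> = (1 - ?\<nu> k) * \<Delta>" unfolding sum_distrib_right[symmetric] sum_group_prob[OF k] ..
  finally have "(1 - ?\<nu> k) * \<bar>(out_loss D g k c - out_loss D g k c') - ?d k\<bar> \<le> (1 - ?\<nu> k) * \<Delta>"
    using pos unfolding eq[symmetric] abs_mult by simp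
  then show ?thesis using pos by (rule mult_left_le_imp_le)
qed

end

text \<open>Both quantities look only at examples of group \<open>k\<close>, on which the decoupled
  classifier is \<open>cs k\<close>.\<close>

lemma (in grouped_examples) decoupled_rates:
  "true_loss D g k (decoupled g cs) = true_loss D g k (cs k)"
  "true_rate D g k (decoupled g cs) = true_rate D g k (cs k)"
proof -
  have "(\<integral>z. \<bar>of_bool (snd z) - decoupled g cs (fst z)\<bar> * of_bool (g (fst z) = k) \<partial>D) =
      (\<integral>z. \<bar>of_bool (snd z) - cs k (fst z)\<bar> * of_bool (g (fst z) = k) \<partial>D)"
    by (intro Bochner_Integration.integral_cong) (auto simp: decoupled_def)
  then show "true_loss D g k (decoupled g cs) = true_loss D g k (cs k)"
    by (simp add: true_loss_def)
  show "true_rate D g k (decoupled g cs) = true_rate D g k (cs k)"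
    unfolding true_rate_def by (intro Bochner_Integration.integral_cong) (auto simp: decoupled_def)
qed

section \<open>Concentration for all groups and classifiers\<close>

locale learning_problem = grouped_examples D X g K
  for D :: "('x \<times> bool) measure" and X g K +
  fixes n :: nat and C :: "'x classifier set" and L :: joint_loss and R \<Delta> \<delta> :: real
    and weight :: "nat \<Rightarrow> nat \<Rightarrow> real" and opt :: "'x optimizer" and vals :: "'x rate_values"
  assumes C: "finite C" "C \<noteq> {}" "\<And>c. c \<in> C \<Longrightarrow> unit_classifier c"
    and L: "monotonic_loss K L" "0 \<le> R" "continuous_loss K (group_prob D g) R L"
    and \<Delta>: "\<And>j k c c'. j \<in> {1..K} \<Longrightarrow> k \<in> {1..K} \<Longrightarrow> c \<in> C \<Longrightarrow> c' \<in> C \<Longrightarrow>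
      \<bar>(true_loss D g j c - true_loss D g j c') - (true_loss D g k c - true_loss D g k c')\<bar> \<le> \<Delta>"
    and n: "0 < n" and \<delta>: "0 < \<delta>" "\<delta> < 1"
    and weight: "optimal_weight (card C) \<Delta> (\<delta> / (4 * real (n + K))) n weight"
    and opt: "optimal_optimizer C opt"
    and vals: "covers_rates C vals"
begin

definition tau :: real where "tau = deviation (card C) K n \<delta>"

definition lam :: real where "lam = ln (8 * real (card C) * real (n + K) / \<delta>)"

lemma card_C: "1 \<le> card C"
  using C by (simp add: Suc_le_eq card_gt_0_iff)

lemma exp_lam: "exp (- lam) = \<delta> / (8 * real (card C) * real (n + K))"
  using card_C n \<delta> by (simp add: lam_def exp_minus)

lemma lam_nonneg: "0 \<le> lam"
proof -
  have "1 * 1 * 1 \<le> 8 * real (card C) * real (n + K)"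
    using card_C n by (intro mult_mono) auto
  then have "1 \<le> 8 * real (card C) * real (n + K) / \<delta>"
    using \<delta> by (simp add: pos_le_divide_eq)
  then show ?thesis by (simp add: lam_def)
qed

lemma tau_eq: "tau = sqrt (2 / real n * lam)"
  by (simp add: tau_def deviation_def lam_def)

lemma tau_nonneg: "0 \<le> tau"
  using lam_nonneg by (simp add: tau_eq)

text \<open>Comparing a group with itself in the hypothesis on \<Delta> gives 0 \<le>
  \<Delta>.\<close>

lemma \<Delta>_nonneg: "k \<in> {1..K} \<Longrightarrow> 0 \<le> \<Delta>"
  using \<Delta>[of k k] C(2) by auto

lemma weight_range: "a + b = n \<Longrightarrow> weight a b \<in> {0..1} \<and> (a = 0 \<longrightarrow> 0 < weight a b)"
  using weight unfolding optimal_weight_def is_arg_min_def by auto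

text \<open>With no in-group examples, positivity of the weight is what keeps these sums away from
  0.\<close>

lemma weight_pos:
  assumes "a + b = n"
  shows "0 < real a + weight a b * real b" and "0 < real a + (weight a b)\<^sup>2 * real b"
proof -
  have w: "0 \<le> weight a b" "a = 0 \<Longrightarrow> 0 < weight a b" "a = 0 \<Longrightarrow> 0 < b"
    using weight_range[OF assms] assms n by auto
  then show "0 < real a + weight a b * real b"
    by (cases "a = 0") (simp_all add: add_pos_nonneg)
  from w show "0 < real a + (weight a b)\<^sup>2 * real b"
    by (cases "a = 0") (simp_all add: add_pos_nonneg)
qed

abbreviation "sample S \<equiv> map S [0..<n]"
abbreviation "ins k S \<equiv> in_group g k (sample S)"
abbreviation "outs k S \<equiv> out_group g k (sample S)"
abbreviation "\<theta> k S \<equiv> weight (length (ins k S)) (length (outs k S))"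
abbreviation "samples \<equiv> Pi\<^sub>M {..<n} (\<lambda>_. D)"

text \<open>The third bound is about the product of loss and group probability: this is a mean over
  all n examples and concentrates however few of them lie in the group. In the fourth bound the
  centre and the threshold depend on the sample through the group sizes and the weight.\<close>

definition typical :: "nat \<Rightarrow> 'x classifier \<Rightarrow> (nat \<Rightarrow> 'x \<times> bool) \<Rightarrow> bool" where
  "typical k c S \<longleftrightarrow>
     \<bar>emp_rate (ins k S) (outs k S) c - true_rate D g k c\<bar> \<le> tau / 2 \<and>
     \<bar>real (length (ins k S)) / real n - group_prob D g k\<bar> \<le> tau / 2 \<and>
     \<bar>real (length (ins k S)) / real n * avg_err (ins k S) c - true_loss D g k c * group_prob D g k\<bar> \<le> tau / 2 \<and>
     \<bar>weighted_err (\<theta> k S) (ins k S) (outs k S) c -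
        (real (length (ins k S)) * true_loss D g k c + \<theta> k S * real (length (outs k S)) * out_loss D g k c)\<bar>
      \<le> sqrt ((real (length (ins k S)) + (\<theta> k S)\<^sup>2 * real (length (outs k S))) * lam / 2)"

lemma typicalD:
  assumes "typical k c S"
  shows "\<bar>emp_rate (ins k S) (outs k S) c - true_rate D g k c\<bar> \<le> tau / 2"
    and "\<bar>real (length (ins k S)) / real n - group_prob D g k\<bar> \<le> tau / 2"
    and "\<bar>real (length (ins k S)) / real n * avg_err (ins k S) c - true_loss D g k c * group_prob D g k\<bar> \<le> tau / 2"
    and "\<bar>weighted_err (\<theta> k S) (ins k S) (outs k S) c -
        (real (length (ins k S)) * true_loss D g k c + \<theta> k S * real (length (outs k S)) * out_loss D g k c)\<bar>
      \<le> sqrt ((real (length (ins k S)) + (\<theta> k S)\<^sup>2 * real (length (outs k S))) * lam / 2)"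
  using assms unfolding typical_def by blast+

lemma sample_lengths: "length (ins k S) + length (outs k S) = n"
  using sum_length_filter_compl[of "\<lambda>z. g (fst z) = k" "sample S"] by simp

lemma sample_in_space: "S \<in> space samples \<Longrightarrow> i < n \<Longrightarrow> S i \<in> space D"
  by (auto simp: space_PiM)

lemma sample_unit:
  assumes "S \<in> space samples" and "c \<in> C" and "z \<in> set (filter Q (sample S))"
  shows "c (fst z) \<in> {0..1}"
proof -
  have "z \<in> space D" using assms(3) sample_in_space[OF assms(1)] by auto
  then show ?thesis by (rule classifier_unit[OF C(3)[OF assms(2)]])
qed

lemma atypical_event:
  assumes c: "c \<in> C"
  obtains E where "E \<in> sets samples" "measure samples E \<le> 8 * exp (- lam)"
    "\<And>S. S \<in> space samples \<Longrightarrow> S \<notin> E \<Longrightarrow> typical k c S"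
proof -
  note uc = C(3)[OF c]
  interpret samples: product_prob_space "\<lambda>_. D" "{..<n}" by unfold_locales
  define mean_event where "mean_event f = {S \<in> space samples. sqrt (2 / real n * lam) / 2 \<le>
      \<bar>(\<Sum>i<n. f (S i)) / real n - (\<integral>z. f z \<partial>D)\<bar>}" for f :: "'x \<times> bool \<Rightarrow> real"
  define f1 where "f1 z = c (fst z) * of_bool (g (fst z) = k)" for z :: "'x \<times> bool"
  define f2 where "f2 z = (of_bool (g (fst z) = k) :: real)" for z :: "'x \<times> bool"
  define f3 where "f3 z = err c z * of_bool (g (fst z) = k)" for z :: "'x \<times> bool"
  \<comment> \<open>The group sizes add up to \<open>n\<close>, so the chosen weight is a function
    of the in-group count alone, as \<open>deviation_event\<close> requires.\<close>
  define w where "w a = weight a (n - a)" for a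
  define E4 where "E4 = deviation_event D {..<n} (group_event k) (err c) (true_loss D g k c) (out_loss D g k c) w lam"
  have [measurable]: "(\<lambda>z. c (fst z)) \<in> borel_measurable D" "err c \<in> borel_measurable D"
    using classifier_meas[OF uc] err_meas[OF uc] by auto
  have meas: "f1 \<in> borel_measurable D" "f2 \<in> borel_measurable D" "f3 \<in> borel_measurable D"
    unfolding f1_def[abs_def] f2_def[abs_def] f3_def[abs_def] by measurable
  have unit: "f1 z \<in> {0..1}" "f2 z \<in> {0..1}" "f3 z \<in> {0..1}" if "z \<in> space D" for z
    using classifier_unit[OF uc that] err_unit[OF uc that] by (auto simp: f1_def f2_def f3_def of_bool_def)
  have E123: "mean_event f \<in> sets samples \<and> measure samples (mean_event f) \<le> 2 * exp (- lam)"
    if "f \<in> {f1, f2, f3}" for f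
    unfolding mean_event_def using that meas unit
    by (intro conjI mean_deviation_event[OF prob_space_axioms _ _ n lam_nonneg]) auto
  have E4: "E4 \<in> sets samples \<and> measure samples E4 \<le> 2 * exp (- lam)"
    unfolding E4_def
  proof (intro conjI deviation_event[OF prob_space_axioms err_meas[OF uc] err_unit[OF uc] group_event_sets _ out_loss_mult[OF uc] finite_lessThan lam_nonneg])
    have "(\<integral>z. err c z * indicator (group_event k) z \<partial>D) = (\<integral>z. err c z * of_bool (g (fst z) = k) \<partial>D)"
      by (intro Bochner_Integration.integral_cong) (auto simp: indicator_group_event)
    then show "(\<integral>z. err c z * indicator (group_event k) z \<partial>D) = true_loss D g k c * measure D (group_event k)"
        "(\<integral>z. err c z * indicator (group_event k) z \<partial>D) = true_loss D g k c * measure D (group_event k)"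
      by (simp_all add: true_loss_mult[OF uc] measure_group_event)
    show "0 < real a + (w a)\<^sup>2 * real b" "0 < real a + (w a)\<^sup>2 * real b" if "a + b = card {..<n}" for a b
      using weight_pos(2)[of a b] that by (auto simp: w_def)
  qed
  define E where "E = (mean_event f1 \<union> mean_event f2) \<union> (mean_event f3 \<union> E4)"
  show ?thesis
  proof (rule that)
    show "E \<in> sets samples" using E123 E4 by (auto simp: E_def)
    have "measure samples E \<le> measure samples (mean_event f1 \<union> mean_event f2) + measure samples (mean_event f3 \<union> E4)"
      unfolding E_def using E123 E4 by (intro measure_Un_le sets.Un) auto
    moreover have "measure samples (mean_event f1 \<union> mean_event f2) \<le> measure samples (mean_event f1) + measure samples (mean_event f2)"
      using E123 by (intro measure_Un_le) auto
    moreover have "measure samples (mean_event f3 \<union> E4) \<le> measure samples (mean_event f3) + measure samples E4"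
      using E123 E4 by (intro measure_Un_le) auto
    ultimately show "measure samples E \<le> 8 * exp (- lam)"
      using E123[of f1] E123[of f2] E123[of f3] E4 by simp
    fix S assume S: "S \<in> space samples" and "S \<notin> E"
    then have "S \<notin> mean_event f1" "S \<notin> mean_event f2" "S \<notin> mean_event f3" and S4: "S \<notin> E4"
      by (auto simp: E_def)
    then have mean: "\<bar>(\<Sum>i<n. f (S i)) / real n - (\<integral>z. f z \<partial>D)\<bar> \<le> tau / 2" if "f \<in> {f1, f2, f3}" for f
      using S that by (auto simp: mean_event_def tau_eq)
    note space_i = sample_in_space[OF S]
    have "emp_rate (ins k S) (outs k S) c = (\<Sum>i<n. f1 (S i)) / real n"
      unfolding emp_rate_def case_prod_beta' of_nat_add[symmetric] sample_lengths
      by (simp add: sum_list_filter_map_upt f1_def)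
    with mean[of f1] have 1: "\<bar>emp_rate (ins k S) (outs k S) c - true_rate D g k c\<bar> \<le> tau / 2"
      by (simp add: true_rate_def f1_def[abs_def])
    have "real (length (ins k S)) = (\<Sum>z \<leftarrow> ins k S. 1)" by (simp add: sum_list_triv)
    also have "\<dots> = (\<Sum>i<n. f2 (S i))" by (simp only: sum_list_filter_map_upt f2_def mult_1)
    finally have len: "real (length (ins k S)) = (\<Sum>i<n. f2 (S i))" .
    have "(\<integral>z. f2 z \<partial>D) = (\<integral>z. indicator (group_event k) z \<partial>D)"
      by (intro Bochner_Integration.integral_cong) (auto simp: f2_def indicator_group_event)
    then have "(\<integral>z. f2 z \<partial>D) = group_prob D g k" by (simp add: measure_group_event)
    with mean[of f2] have 2: "\<bar>real (length (ins k S)) / real n - group_prob D g k\<bar> \<le> tau / 2"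
      unfolding len by simp
    have sum3: "real (length (ins k S)) * avg_err (ins k S) c = (\<Sum>i<n. f3 (S i))"
      unfolding length_mult_avg_err sum_list_filter_map_upt f3_def ..
    have "(\<integral>z. f3 z \<partial>D) = true_loss D g k c * group_prob D g k"
      by (simp add: f3_def[abs_def] true_loss_mult[OF uc])
    with mean[of f3] have 3: "\<bar>real (length (ins k S)) / real n * avg_err (ins k S) c - true_loss D g k c * group_prob D g k\<bar> \<le> tau / 2"
      unfolding times_divide_eq_left sum3 by simp
    have event_iff: "S i \<in> group_event k \<longleftrightarrow> g (fst (S i)) = k" if "i < n" for i
      using space_i[OF that] by (simp add: group_event_def)
    have a: "card {i \<in> {..<n}. S i \<in> group_event k} = length (ins k S)"
      unfolding length_filter_map_upt lessThan_iff using event_iff by (intro arg_cong[where f = card]) blast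
    have b: "card {i \<in> {..<n}. S i \<notin> group_event k} = length (outs k S)"
      unfolding length_filter_map_upt lessThan_iff using event_iff by (intro arg_cong[where f = card]) blast
    have wa: "w (length (ins k S)) = \<theta> k S"
      unfolding w_def by (subst sample_lengths[of k S, symmetric]) simp
    have wd: "weighted_deviation {..<n} (group_event k) (err c) (true_loss D g k c) (out_loss D g k c) (\<theta> k S) S =
        weighted_err (\<theta> k S) (ins k S) (outs k S) c -
        (real (length (ins k S)) * true_loss D g k c + \<theta> k S * real (length (outs k S)) * out_loss D g k c)"
      (is "_ = ?rhs")
    proof -
      have "weighted_deviation {..<n} (group_event k) (err c) (true_loss D g k c) (out_loss D g k c) (\<theta> k S) S =
          (\<Sum>i<n. (err c (S i) - true_loss D g k c) * of_bool (g (fst (S i)) = k)) +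
          \<theta> k S * (\<Sum>i<n. (err c (S i) - out_loss D g k c) * of_bool (g (fst (S i)) \<noteq> k))"
        unfolding weighted_deviation_def sum_distrib_left sum.distrib[symmetric]
        by (intro sum.cong refl) (simp add: event_iff)
      also have "\<dots> = (\<Sum>z \<leftarrow> ins k S. err c z - true_loss D g k c) + \<theta> k S * (\<Sum>z \<leftarrow> outs k S. err c z - out_loss D g k c)"
        by (simp only: sum_list_filter_map_upt)
      also have "\<dots> = ?rhs"
        unfolding weighted_err_def mult.assoc length_mult_avg_err sum_list_subtractf sum_list_triv right_diff_distrib
        by simp
      finally show ?thesis .
    qed
    have 4: "\<bar>?rhs\<bar> \<le> sqrt ((real (length (ins k S)) + (\<theta> k S)\<^sup>2 * real (length (outs k S))) * lam / 2)"
      using S4 S unfolding E4_def deviation_event_def mem_Collect_eq a b Let_def wa wd by auto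
    show "typical k c S" unfolding typical_def using 1 2 3 4 by blast
  qed
qed

lemma typical_event:
  obtains E where "E \<in> sets samples" "1 - \<delta> \<le> measure samples E"
    "\<And>S k c. S \<in> E \<Longrightarrow> k \<in> {1..K} \<Longrightarrow> c \<in> C \<Longrightarrow> typical k c S" "E \<subseteq> space samples"
proof -
  interpret samples: product_prob_space "\<lambda>_. D" "{..<n}" by unfold_locales
  have "\<forall>kc \<in> {1..K} \<times> C. \<exists>E. E \<in> sets samples \<and> measure samples E \<le> 8 * exp (- lam) \<and>
      (\<forall>S \<in> space samples. S \<notin> E \<longrightarrow> typical (fst kc) (snd kc) S)"
  proof
    fix kc assume "kc \<in> {1..K} \<times> C"
    then have "snd kc \<in> C" by auto
    then show "\<exists>E. E \<in> sets samples \<and> measure samples E \<le> 8 * exp (- lam) \<and>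
        (\<forall>S \<in> space samples. S \<notin> E \<longrightarrow> typical (fst kc) (snd kc) S)"
    proof (rule atypical_event[where k = "fst kc"])
      fix E assume "E \<in> sets samples" "measure samples E \<le> 8 * exp (- lam)"
        "\<And>S. S \<in> space samples \<Longrightarrow> S \<notin> E \<Longrightarrow> typical (fst kc) (snd kc) S"
      then show ?thesis by (intro exI[of _ E] conjI ballI impI)
    qed
  qed
  from bchoice[OF this] obtain A where "\<forall>kc \<in> {1..K} \<times> C. A kc \<in> sets samples \<and> measure samples (A kc) \<le> 8 * exp (- lam) \<and>
      (\<forall>S \<in> space samples. S \<notin> A kc \<longrightarrow> typical (fst kc) (snd kc) S)" ..
  note A = bspec[OF this]
  have A_sets: "A kc \<in> sets samples" and A_le: "measure samples (A kc) \<le> 8 * exp (- lam)"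
    if "kc \<in> {1..K} \<times> C" for kc using A[OF that] by simp_all
  define U where "U = (\<Union>kc \<in> {1..K} \<times> C. A kc)"
  have fin: "finite ({1..K} \<times> C)" using C(1) by simp
  have U: "U \<in> sets samples" unfolding U_def by (intro sets.finite_UN[OF fin] A_sets)
  have "measure samples U \<le> (\<Sum>kc \<in> {1..K} \<times> C. measure samples (A kc))"
    unfolding U_def by (intro samples.finite_measure_subadditive_finite[OF fin]) (rule image_subsetI[OF A_sets])
  also have "\<dots> \<le> (\<Sum>kc \<in> {1..K} \<times> C. 8 * exp (- lam))"
    by (intro sum_mono A_le)
  \<comment> \<open>Four bounds at 2 exp (- \<open>lam\<close>) each, over all pairs of group and
    classifier: the factor 8 and the size of \<open>C\<close> cancel against
    \<open>exp_lam\<close>.\<close>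
  also have "\<dots> = \<delta> * (real K / real (n + K))"
    using card_C by (simp add: card_cartesian_product exp_lam del: of_nat_add)
  also have "\<dots> \<le> \<delta> * 1" using \<delta> n by (intro mult_left_mono) auto
  finally have "measure samples U \<le> \<delta>" by simp
  show ?thesis
  proof (rule that)
    show "space samples - U \<in> sets samples" using U by auto
    show "1 - \<delta> \<le> measure samples (space samples - U)"
      using \<open>measure samples U \<le> \<delta>\<close> by (simp add: samples.prob_compl[OF U])
    show "typical k c S" if "S \<in> space samples - U" "k \<in> {1..K}" "c \<in> C" for S k c
    proof -
      have kc: "(k, c) \<in> {1..K} \<times> C" using that by simp
      then have "S \<notin> A (k, c)" using that(1) unfolding U_def by blast
      with A[OF kc] that(1) show ?thesis by simp
    qed
  qed auto
qed

section \<open>The guarantee on a typical sample\<close>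

text \<open>With r = \<open>n\<^sub>k / n\<close> and e the empirical loss, \<nu> (l - e) = (r -
  \<nu>) e - (r e - l \<nu>), and both terms are at most \<tau>/2 in absolute value because e lies
  in the unit interval. No division by \<nu> or by the number of in-group examples occurs.\<close>

lemma typical_loss_error:
  assumes S: "S \<in> space samples" and c: "c \<in> C" and "typical k c S"
  shows "group_prob D g k * \<bar>true_loss D g k c - avg_err (ins k S) c\<bar> \<le> tau"
proof -
  let ?\<nu> = "group_prob D g k" and ?r = "real (length (ins k S)) / real n" and ?e = "avg_err (ins k S) c"
  have e: "?e \<in> {0..1}"
    by (intro avg_err_unit_interval sample_unit[OF S c])
  have "?\<nu> * \<bar>true_loss D g k c - ?e\<bar> = \<bar>?\<nu> * (true_loss D g k c - ?e)\<bar>"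
    using group_prob_unit[of k] by (simp add: abs_mult)
  also have "?\<nu> * (true_loss D g k c - ?e) = (?r - ?\<nu>) * ?e - (?r * ?e - true_loss D g k c * ?\<nu>)"
    by (simp add: algebra_simps)
  also have "\<bar>\<dots>\<bar> \<le> \<bar>?r - ?\<nu>\<bar> * \<bar>?e\<bar> + \<bar>?r * ?e - true_loss D g k c * ?\<nu>\<bar>"
    unfolding abs_mult[symmetric] by (rule abs_triangle_ineq4)
  also have "\<dots> \<le> tau / 2 * 1 + tau / 2"
    using e tau_nonneg by (intro add_mono mult_mono typicalD[OF assms(3)]) simp_all
  finally show ?thesis by simp
qed

text \<open>\<open>transfer_excess\<close> with the out-group losses as r gives exactly the quantity
  that the weight minimizes. The bound is nonnegative, so it also holds for the positive part of the
  excess, and the factor \<nu> is then at most 1.\<close>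

lemma typical_transfer:
  assumes k: "k \<in> {1..K}" and c: "c \<in> C" "typical k c S" and c': "c' \<in> C" "typical k c' S"
    and W: "weighted_err (\<theta> k S) (ins k S) (outs k S) c' \<le> weighted_err (\<theta> k S) (ins k S) (outs k S) c"
  shows "group_prob D g k * max 0 (true_loss D g k c' - true_loss D g k c)
    \<le> tau + transfer_term tau \<Delta> (group_prob D g k)"
proof -
  let ?a = "length (ins k S)" and ?b = "length (outs k S)"
  let ?V = "real ?a + (\<theta> k S)\<^sup>2 * real ?b"
  note ab = sample_lengths[of k S]
  note shift = out_loss_shift[OF k C(3)[OF c'(1)] C(3)[OF c(1)] \<Delta>_nonneg[OF k] \<Delta>[OF _ k c'(1) c(1)]]
  have "true_loss D g k c' - true_loss D g k c
      \<le> (2 * sqrt (?V * lam / 2) + \<theta> k S * real ?b * \<Delta>) / (real ?a + \<theta> k S * real ?b)"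
  proof (rule transfer_excess[OF weight_pos(1)[OF ab] _ W typicalD(4)[OF c(2)] typicalD(4)[OF c'(2)] shift])
    show "0 \<le> \<theta> k S" using weight_range[OF ab] by simp
  qed
  also have "\<dots> = transfer_bound (card C) \<Delta> (\<delta> / (4 * real (n + K))) ?a ?b (\<theta> k S)"
  proof -
    \<comment> \<open>The deviations of the two classifiers add up to the square root in
      \<open>transfer_bound\<close>.\<close>
    have "sqrt (2 * ?V * lam) = sqrt (2\<^sup>2 * (?V * lam / 2))" by (simp add: power2_eq_square)
    also have "\<dots> = 2 * sqrt (?V * lam / 2)" by (simp only: real_sqrt_mult real_sqrt_abs abs_numeral)
    finally have root: "2 * sqrt (?V * lam / 2) = sqrt (2 * ?V * lam)" ..
    have log: "ln (2 * real (card C) / (\<delta> / (4 * real (n + K)))) = lam"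
      by (simp add: lam_def algebra_simps)
    show ?thesis unfolding transfer_bound_def log root by simp
  qed
  also have "\<dots> \<le> tau + transfer_term tau \<Delta> (group_prob D g k)"
    unfolding tau_def
    by (rule transfer_bound_optimal[OF weight ab n \<Delta>_nonneg[OF k] lam_nonneg[unfolded lam_def] typicalD(2)[OF c(2), unfolded tau_def]])
  finally have excess: "max 0 (true_loss D g k c' - true_loss D g k c) \<le> tau + transfer_term tau \<Delta> (group_prob D g k)"
    using tau_nonneg transfer_term_nonneg[OF tau_nonneg \<Delta>_nonneg[OF k]] by simp
  have "group_prob D g k * max 0 (true_loss D g k c' - true_loss D g k c) \<le> 1 * max 0 (true_loss D g k c' - true_loss D g k c)"
    using group_prob_unit[of k] by (intro mult_right_mono) auto
  also note mult_1
  also note excess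
  finally show ?thesis .
qed

text \<open>The target \<open>c\<close> is one classifier for all groups, but the competitor
  \<open>d\<close> it is matched with is a tuple: \<open>d k\<close> is what the learner of group
  \<open>k\<close> offers at the empirical rate of \<open>c\<close>. The output minimizes the
  empirical joint loss over all tuples, hence does at least as well as \<open>d\<close> on the
  sample.\<close>

lemma general_decouple_typical:
  assumes S: "S \<in> space samples" and all_typical: "\<And>k c. k \<in> {1..K} \<Longrightarrow> c \<in> C \<Longrightarrow> typical k c S" and c: "c \<in> C"
  shows "\<exists>c'. result (general_decouple K g L weight opt vals (sample S)) = Some c' \<and>
    true_joint_loss D g L c' \<le> true_joint_loss D g L c + 5 * R * real K * tau
      + R * (\<Sum>k = 1..K. transfer_term tau \<Delta> (group_prob D g k))"
proof -
  define Ck where "Ck k = set (result (transfer_learner weight opt vals (ins k S) (outs k S)))" for k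
  note w = weight_range[OF sample_lengths, THEN conjunct1]
  have Ck_C: "c' \<in> C" if "c' \<in> Ck k" for c' k
    using transfer_learner_in_class[where weight = weight and ins = "ins k S" and outs = "outs k S", OF opt w[of k S]] that
    by (simp add: Ck_def)
  have "\<exists>c'. c' \<in> Ck k \<and> emp_rate (ins k S) (outs k S) c' = emp_rate (ins k S) (outs k S) c \<and>
      weighted_err (\<theta> k S) (ins k S) (outs k S) c' \<le> weighted_err (\<theta> k S) (ins k S) (outs k S) c" for k
    by (rule transfer_learner_competes[where weight = weight and ins = "ins k S" and outs = "outs k S", OF opt w[of k S] vals c]) (auto simp: Ck_def)
  then obtain d where d: "\<And>k. d k \<in> Ck k"
    "\<And>k. emp_rate (ins k S) (outs k S) (d k) = emp_rate (ins k S) (outs k S) c"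
    "\<And>k. weighted_err (\<theta> k S) (ins k S) (outs k S) (d k) \<le> weighted_err (\<theta> k S) (ins k S) (outs k S) c"
    by metis
  have emp_unit: "avg_err (ins k S) c' \<in> {0..1} \<and> emp_rate (ins k S) (outs k S) c' \<in> {0..1}" if "c' \<in> C" for k c'
    by (intro conjI avg_err_unit_interval emp_rate_unit_interval sample_unit[OF S that])
  obtain cs where cs: "result (general_decouple K g L weight opt vals (sample S)) = Some (decoupled g cs)"
    "\<And>k. k \<in> {1..K} \<Longrightarrow> cs k \<in> Ck k"
    "\<And>cs'. (\<And>k. k \<in> {1..K} \<Longrightarrow> cs' k \<in> Ck k) \<Longrightarrow>
       L (\<lambda>k. avg_err (ins k S) (cs k)) (\<lambda>k. emp_rate (ins k S) (outs k S) (cs k))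
       \<le> L (\<lambda>k. avg_err (ins k S) (cs' k)) (\<lambda>k. emp_rate (ins k S) (outs k S) (cs' k))"
  proof (rule general_decouple_minimizes[where K = K and L = L and g = g and weight = weight and opt = opt and vals = vals and zs = "sample S"], fold Ck_def)
    show "L l p = L l' p'" if "\<And>k. k \<in> {1..K} \<Longrightarrow> l k = l' k \<and> p k = p' k \<and> l' k \<in> {0..1} \<and> p' k \<in> {0..1}" for l l' p p'
      using continuous_loss_cong[OF L(3) that] .
    show "avg_err (ins k S) c' \<in> {0..1} \<and> emp_rate (ins k S) (outs k S) c' \<in> {0..1}" if "c' \<in> Ck k" for k c'
      by (intro emp_unit Ck_C[OF that])
    show "Ck k \<noteq> {}" for k using d(1)[of k] by blast
  next
    fix cs
    assume "result (general_decouple K g L weight opt vals (sample S)) = Some (decoupled g cs)"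
      and "\<And>k. k \<in> {1..K} \<Longrightarrow> cs k \<in> Ck k"
      and "\<And>cs'. (\<And>k. k \<in> {1..K} \<Longrightarrow> cs' k \<in> Ck k) \<Longrightarrow>
         L (\<lambda>k. avg_err (ins k S) (cs k)) (\<lambda>k. emp_rate (ins k S) (outs k S) (cs k))
         \<le> L (\<lambda>k. avg_err (ins k S) (cs' k)) (\<lambda>k. emp_rate (ins k S) (outs k S) (cs' k))"
    from that[OF this] show thesis .
  qed
  have cs_C: "cs k \<in> C" if "k \<in> {1..K}" for k using Ck_C cs(2) that by blast
  have d_C: "d k \<in> C" for k using Ck_C d(1) by blast
  have "true_joint_loss D g L (decoupled g cs) = L (\<lambda>k. true_loss D g k (cs k)) (\<lambda>k. true_rate D g k (cs k))"
    by (simp add: true_joint_loss_def decoupled_rates)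
  also have "\<dots> \<le> L (\<lambda>k. true_loss D g k c) (\<lambda>k. true_rate D g k c) + 5 * R * real K * tau
      + R * (\<Sum>k = 1..K. transfer_term tau \<Delta> (group_prob D g k))"
  proof (rule joint_loss_chain[OF L(1,3,2), where
        lo' = "\<lambda>k. avg_err (ins k S) (cs k)" and po' = "\<lambda>k. emp_rate (ins k S) (outs k S) (cs k)" and
        lt = "\<lambda>k. true_loss D g k (d k)" and pt = "\<lambda>k. true_rate D g k (d k)" and
        lt' = "\<lambda>k. avg_err (ins k S) (d k)" and pt' = "\<lambda>k. emp_rate (ins k S) (outs k S) (d k)"])
    show "L (\<lambda>k. avg_err (ins k S) (cs k)) (\<lambda>k. emp_rate (ins k S) (outs k S) (cs k))
       \<le> L (\<lambda>k. avg_err (ins k S) (d k)) (\<lambda>k. emp_rate (ins k S) (outs k S) (d k))"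
      using cs(3) d(1) .
  next
    fix k assume k: "k \<in> {1..K}"
    note t = all_typical[OF k cs_C[OF k]] all_typical[OF k d_C[of k]] all_typical[OF k c]
    show "group_prob D g k * \<bar>true_loss D g k (cs k) - avg_err (ins k S) (cs k)\<bar> \<le> tau \<and>
        \<bar>true_rate D g k (cs k) - emp_rate (ins k S) (outs k S) (cs k)\<bar> \<le> tau / 2 \<and>
        group_prob D g k * \<bar>true_loss D g k (d k) - avg_err (ins k S) (d k)\<bar> \<le> tau \<and>
        \<bar>true_rate D g k (d k) - emp_rate (ins k S) (outs k S) (d k)\<bar> \<le> tau / 2"
      using typical_loss_error[OF S cs_C[OF k] t(1)] typical_loss_error[OF S d_C[of k] t(2)]
        typicalD(1)[OF t(1)] typicalD(1)[OF t(2)] abs_minus_commute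
      by metis
    \<comment> \<open>The empirical rates of \<open>d k\<close> and \<open>c\<close> coincide, so
      the true rates are two deviations of \<tau>/2 apart.\<close>
    have "\<bar>true_rate D g k (d k) - true_rate D g k c\<bar> \<le> tau"
      using typicalD(1)[OF t(2)] typicalD(1)[OF t(3)] unfolding d(2) by linarith
    then show "group_prob D g k * max 0 (true_loss D g k (d k) - true_loss D g k c)
        \<le> tau + transfer_term tau \<Delta> (group_prob D g k) \<and>
        \<bar>true_rate D g k (d k) - true_rate D g k c\<bar> \<le> tau"
      using typical_transfer[OF k c t(3) d_C[of k] t(2) d(3)] by blast
  qed (auto intro!: Pi_I emp_unit[THEN conjunct1] emp_unit[THEN conjunct2] true_loss_unit true_rate_unit C(3) cs_C d_C c
      simp del: atLeastAtMost_iff)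
  finally show ?thesis using cs(1) by (auto simp: true_joint_loss_def)
qed

end

theorem theorem3:
  fixes K n :: nat
    and X :: "'x measure" and D :: "('x \<times> bool) measure" and g :: "'x \<Rightarrow> nat"
    and C :: "'x classifier set" and L :: joint_loss and R \<Delta> \<delta> :: real
    and weight :: "nat \<Rightarrow> nat \<Rightarrow> real" and opt :: "'x optimizer" and vals :: "'x rate_values"
  defines "\<tau> \<equiv> deviation (card C) K n \<delta>"
  assumes D: "prob_space D" "sets D = sets (X \<Otimes>\<^sub>M count_space UNIV)"
    and g: "g \<in> measurable X (count_space {1..K})"
    and C: "finite C" "C \<noteq> {}"
      "\<And>c. c \<in> C \<Longrightarrow> c \<in> borel_measurable X" "\<And>c. c \<in> C \<Longrightarrow> c \<in> space X \<rightarrow> {0..1}"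
    and L: "monotonic_loss K L" "0 \<le> R" "continuous_loss K (group_prob D g) R L"
    and \<Delta>: "\<And>j k c c'. j \<in> {1..K} \<Longrightarrow> k \<in> {1..K} \<Longrightarrow> c \<in> C \<Longrightarrow> c' \<in> C \<Longrightarrow>
      \<bar>(true_loss D g j c - true_loss D g j c') - (true_loss D g k c - true_loss D g k c')\<bar> \<le> \<Delta>"
    and n: "0 < n" and \<delta>: "0 < \<delta>"
    and weight: "optimal_weight (card C) \<Delta> (\<delta> / (4 * real (n + K))) n weight"
    and opt: "optimal_optimizer C opt"
    and vals: "covers_rates C vals"
  shows
    "(\<exists>E \<in> sets (Pi\<^sub>M {..<n} (\<lambda>_. D)).
        1 - \<delta> \<le> measure (Pi\<^sub>M {..<n} (\<lambda>_. D)) E \<and>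
        (\<forall>S \<in> E. \<exists>c'. result (general_decouple K g L weight opt vals (map S [0..<n])) = Some c' \<and>
           true_joint_loss D g L c'
             \<le> (MIN c \<in> C. true_joint_loss D g L c) + 5 * R * real K * \<tau>
               + R * (\<Sum>k = 1..K. transfer_term \<tau> \<Delta> (group_prob D g k))))
     \<and> (\<exists>q :: nat poly poly.
        \<forall>(g :: 'x \<Rightarrow> nat) L weight opt vals zs t.
          (\<forall>a b. a + b = length zs \<longrightarrow> weight a b \<in> {0..1}) \<longrightarrow> few_rates vals \<longrightarrow> optimizer_time opt (length zs) t \<longrightarrow>
          steps (general_decouple K g L weight opt vals zs) \<le> poly (poly q [:t:]) (length zs))"
proof (intro conjI general_decouple_polynomial_time)
  show "\<exists>E \<in> sets (Pi\<^sub>M {..<n} (\<lambda>_. D)).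
        1 - \<delta> \<le> measure (Pi\<^sub>M {..<n} (\<lambda>_. D)) E \<and>
        (\<forall>S \<in> E. \<exists>c'. result (general_decouple K g L weight opt vals (map S [0..<n])) = Some c' \<and>
           true_joint_loss D g L c'
             \<le> (MIN c \<in> C. true_joint_loss D g L c) + 5 * R * real K * \<tau>
               + R * (\<Sum>k = 1..K. transfer_term \<tau> \<Delta> (group_prob D g k)))"
  proof (cases "\<delta> < 1")
    case False
    \<comment> \<open>For \<delta> \<ge> 1 the required probability is at most 0, and the empty
      event suffices.\<close>
    then show ?thesis by (intro bexI[of _ "{}"]) auto
  next
    case True
    interpret grouped_examples D X g K
      using D g by (simp add: grouped_examples_def grouped_examples_axioms_def)
    interpret learning_problem D X g K n C L R \<Delta> \<delta> weight opt vals
      using C L \<Delta> n \<delta> True weight opt vals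
      by unfold_locales (auto simp: unit_classifier_def)
    have "(MIN c \<in> C. true_joint_loss D g L c) \<in> true_joint_loss D g L ` C"
      using C by (intro Min_in) auto
    \<comment> \<open>The minimum over the finite class is attained, so a bound against this single
      target is enough.\<close>
    then obtain c where c: "c \<in> C" "(MIN c \<in> C. true_joint_loss D g L c) = true_joint_loss D g L c" by blast
    obtain E where "E \<in> sets (Pi\<^sub>M {..<n} (\<lambda>_. D))" "1 - \<delta> \<le> measure (Pi\<^sub>M {..<n} (\<lambda>_. D)) E"
      "\<And>S k c. S \<in> E \<Longrightarrow> k \<in> {1..K} \<Longrightarrow> c \<in> C \<Longrightarrow> typical k c S" "E \<subseteq> space (Pi\<^sub>M {..<n} (\<lambda>_. D))"
      using typical_event by blast
    with general_decouple_typical[OF _ _ c(1)] show ?thesis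
      unfolding c(2) \<tau>_def tau_def by (intro bexI[of _ E]) blast+
  qed
qed

end
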